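(* Let $X\neq\{0\}$ be a complex Banach space. For $x\in B_X$ let $\delta(x)\in\mathcal G_0(B_X)$ be the evaluation functional $\delta(x)(f)=f(x)$, $f\in\mathcal HL_0(B_X)$. (a) The mapping $\delta: B_X\to\mathcal G_0(B_X)$, $x\mapsto\delta(x)$, is holomorphic and $\|\delta(x)-\delta(y)\|=\|x-y\|$ for every $x,y\in B_X$. In particular $\delta\in\mathcal HL_0(B_X,\mathcal G_0(B_X))$ with $L(\delta)=1$. (b) $\mathcal G_0(B_X)=\overline{\operatorname{span}}\{\delta(x): x\in B_X\}$. (c) For any complex Banach space $Y$ and any $f\in\mathcal HL_0(B_X,Y)$ there is a unique operator $T_f\in\mathcal L(\mathcal G_0(B_X),Y)$ such that $T_f\circ\delta=f$. The map $f\mapsto T_f$ is an isometric isomorphism from $\mathcal HL_0(B_X,Y)$ onto $\mathcal L(\mathcal G_0(B_X),Y)$. These properties characterize $\mathcal G_0(B_X)$ uniquely up to an isometric isomorphism: if $Z$ is a complex Banach space and $\delta_Z\in\mathcal HL_0(B_X,Z)$ are such that for every complex Banach space $Y$ and every $f\in\mathcal HL_0(B_X,Y)$ there is a unique $S_f\in\mathcal L(Z,Y)$ with $S_f\circ\delta_Z=f$, and $f\mapsto S_f$ is an isometric isomorphism from $\mathcal HL_0(B_X,Y)$ onto $\mathcal L(Z,Y)$, then $Z$ is isometrically isomorphic to $\mathcal G_0(B_X)$. (d) A bounded net $(f_\alpha)\subset\mathcal HL_0(B_X)$ is weak-star convergent to a function $f\in\mathcal HL_0(B_X)$ if and only if $f_\alpha(x)\to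 f(x)$ for every $x\in B_X$.
   Context: $B_X$ is the open unit ball of $X$; $\mathcal L(E,F)$ is the space of bounded linear operators with the operator norm. For complex Banach spaces $X,Y$, $\mathcal HL_0(B_X,Y)$ is the Banach space of holomorphic Lipschitz maps $f:B_X\to Y$ with $f(0)=0$, normed by the Lipschitz constant $L(f)$; $\mathcal HL_0(B_X)=\mathcal HL_0(B_X,\mathbb C)$. Let $\tau_0$ be the compact-open topology (uniform convergence on compact subsets of $B_X$). Define $\mathcal G_0(B_X)=\{\varphi\in\mathcal HL_0(B_X)^*: \varphi \text{ restricted to } \{f:L(f)\le1\}\text{ is }\tau_0\text{-continuous}\}$, with the norm of $\mathcal HL_0(B_X)^*$. By the Dixmier-Ng theorem $\mathcal HL_0(B_X)=\mathcal G_0(B_X)^*$ isometrically via $\langle f,\varphi\rangle=\varphi(f)$; the weak-star topology in (d) is the one from this duality. *)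

theory Defs
  imports "HOL-Analysis.Analysis"
begin

section \<open>Complex Banach spaces\<close>

class complex_vector = real_vector +
  fixes scaleC :: "complex \<Rightarrow> 'a \<Rightarrow> 'a"  (infixr "*\<^sub>C" 75)
  assumes scaleC_add_right: "c *\<^sub>C (x + y) = c *\<^sub>C x + c *\<^sub>C y"
    and scaleC_add_left: "(c + d) *\<^sub>C x = c *\<^sub>C x + d *\<^sub>C x"
    and scaleC_scaleC: "c *\<^sub>C d *\<^sub>C x = (c * d) *\<^sub>C x"
    and scaleR_scaleC: "r *\<^sub>R x = complex_of_real r *\<^sub>C x"

class complex_normed_vector = complex_vector + real_normed_vector +
  assumes norm_scaleC: "norm (c *\<^sub>C x) = cmod c * norm x"

class cbanach = complex_normed_vector + banach

instantiation complex :: cbanach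
begin
definition scaleC_complex :: "complex \<Rightarrow> complex \<Rightarrow> complex" where
  "scaleC_complex c x = c * x"
instance
  by standard (simp_all add: scaleC_complex_def algebra_simps norm_mult scaleR_conv_of_real)
end

lemma scaleC_one: "1 *\<^sub>C x = (x :: 'a::complex_vector)"
  using scaleR_scaleC[of 1 x] by simp

lemma scaleC_minus_right: "c *\<^sub>C (- x) = - (c *\<^sub>C (x :: 'a::complex_vector))"
proof -
  have "- x = (- 1) *\<^sub>R x" by simp
  also have "\<dots> = (- 1) *\<^sub>C x" by (subst scaleR_scaleC) simp
  finally have "c *\<^sub>C (- x) = (- 1) *\<^sub>C (c *\<^sub>C x)"
    by (simp add: scaleC_scaleC)
  also have "\<dots> = (- 1) *\<^sub>R (c *\<^sub>C x)" by (subst scaleR_scaleC) simp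
  finally show ?thesis by simp
qed

lemma scaleC_diff_right: "c *\<^sub>C (x - y) = c *\<^sub>C x - c *\<^sub>C (y :: 'a::complex_vector)"
  using scaleC_add_right[of c x "- y"] by (simp add: scaleC_minus_right)

lemma scaleC_zero_right: "c *\<^sub>C 0 = (0 :: 'a::complex_vector)"
  using scaleC_diff_right[of c 0 0] by simp

lemma scaleC_scaleR: "c *\<^sub>C r *\<^sub>R x = r *\<^sub>R c *\<^sub>C (x :: 'a::complex_vector)"
  by (simp add: scaleR_scaleC scaleC_scaleC mult.commute)

lemma bounded_linear_scaleC: "bounded_linear ((*\<^sub>C) c :: 'a \<Rightarrow> 'a::complex_normed_vector)"
  by (rule bounded_linear_intro[where K = "cmod c"])
    (simp_all add: scaleC_add_right scaleC_scaleR norm_scaleC mult.commute)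

global_interpretation complex_vector: vector_space "scaleC :: complex \<Rightarrow> 'a \<Rightarrow> 'a::complex_vector"
  defines cspan = complex_vector.span
  by standard (simp_all add: scaleC_add_right scaleC_add_left scaleC_scaleC scaleC_one)


section \<open>Bounded complex-linear operators\<close>

definition bounded_clinear :: "('a::complex_normed_vector \<Rightarrow> 'b::complex_normed_vector) \<Rightarrow> bool" where
  "bounded_clinear f \<longleftrightarrow> bounded_linear f \<and> (\<forall>c x. f (c *\<^sub>C x) = c *\<^sub>C f x)"

definition isometric_isomorphism ::
    "('a::complex_normed_vector \<Rightarrow> 'b::complex_normed_vector) \<Rightarrow> bool" where
  "isometric_isomorphism f \<longleftrightarrow> bounded_clinear f \<and> (\<forall>x. norm (f x) = norm x) \<and> surj f"

typedef (overloaded) ('a, 'b) cblinfun =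
  "{f :: 'a::complex_normed_vector \<Rightarrow> 'b::complex_normed_vector. bounded_clinear f}"
  morphisms cblinfun_apply Cblinfun
  by (rule exI[of _ "\<lambda>_. 0"]) (simp add: bounded_clinear_def scaleC_zero_right)

setup_lifting type_definition_cblinfun

instantiation cblinfun :: (complex_normed_vector, complex_normed_vector) complex_normed_vector
begin

lift_definition norm_cblinfun :: "('a, 'b) cblinfun \<Rightarrow> real" is onorm .

lift_definition zero_cblinfun :: "('a, 'b) cblinfun" is "\<lambda>x. 0"
  by (simp add: bounded_clinear_def scaleC_zero_right)

lift_definition plus_cblinfun :: "('a, 'b) cblinfun \<Rightarrow> ('a, 'b) cblinfun \<Rightarrow> ('a, 'b) cblinfun"
  is "\<lambda>f g x. f x + g x"
  by (simp add: bounded_clinear_def scaleC_add_right bounded_linear_add)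

lift_definition minus_cblinfun :: "('a, 'b) cblinfun \<Rightarrow> ('a, 'b) cblinfun \<Rightarrow> ('a, 'b) cblinfun"
  is "\<lambda>f g x. f x - g x"
  by (simp add: bounded_clinear_def scaleC_diff_right bounded_linear_sub)

lift_definition uminus_cblinfun :: "('a, 'b) cblinfun \<Rightarrow> ('a, 'b) cblinfun"
  is "\<lambda>f x. - f x"
  by (simp add: bounded_clinear_def scaleC_minus_right bounded_linear_minus)

lift_definition scaleR_cblinfun :: "real \<Rightarrow> ('a, 'b) cblinfun \<Rightarrow> ('a, 'b) cblinfun"
  is "\<lambda>r f x. r *\<^sub>R f x"
  by (simp add: bounded_clinear_def scaleC_scaleR bounded_linear_const_scaleR)

lift_definition scaleC_cblinfun :: "complex \<Rightarrow> ('a, 'b) cblinfun \<Rightarrow> ('a, 'b) cblinfun"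
  is "\<lambda>c f x. c *\<^sub>C f x"
  by (simp add: bounded_clinear_def scaleC_scaleC mult.commute
      bounded_linear_compose[OF bounded_linear_scaleC])

definition dist_cblinfun :: "('a, 'b) cblinfun \<Rightarrow> ('a, 'b) cblinfun \<Rightarrow> real" where
  "dist_cblinfun f g = norm (f - g)"

definition sgn_cblinfun :: "('a, 'b) cblinfun \<Rightarrow> ('a, 'b) cblinfun" where
  "sgn_cblinfun f = inverse (norm f) *\<^sub>R f"

definition uniformity_cblinfun :: "(('a, 'b) cblinfun \<times> ('a, 'b) cblinfun) filter" where
  "uniformity_cblinfun = (INF e\<in>{0 <..}. principal {(f, g). dist f g < e})"

definition open_cblinfun :: "('a, 'b) cblinfun set \<Rightarrow> bool" where
  "open_cblinfun S = (\<forall>f\<in>S. \<forall>\<^sub>F (f', g) in uniformity. f' = f \<longrightarrow> g \<in> S)"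

lemma onorm_scaleC:
  assumes "bounded_linear (f :: 'a \<Rightarrow> 'b)"
  shows "onorm (\<lambda>x. c *\<^sub>C f x) = cmod c * onorm f"
proof -
  have "onorm (\<lambda>x. c *\<^sub>C f x) = onorm (\<lambda>x. cmod c *\<^sub>R f x)"
    by (simp add: onorm_def norm_scaleC)
  then show ?thesis using onorm_scaleR[OF assms, of "cmod c"] by simp
qed

instance
proof
  fix f g h :: "('a, 'b) cblinfun" and c d :: complex and r s :: real
  show "f + g + h = f + (g + h)" by transfer (simp add: add.assoc)
  show "f + g = g + f" by transfer (simp add: add.commute)
  show "0 + f = f" by transfer simp
  show "- f + f = 0" by transfer simp
  show "f - g = f + - g" by transfer simp
  show "r *\<^sub>R (f + g) = r *\<^sub>R f + r *\<^sub>R g" by transfer (simp add: scaleR_add_right)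
  show "(r + s) *\<^sub>R f = r *\<^sub>R f + s *\<^sub>R f" by transfer (simp add: scaleR_add_left)
  show "r *\<^sub>R s *\<^sub>R f = (r * s) *\<^sub>R f" by transfer simp
  show "1 *\<^sub>R f = f" by transfer simp
  show "c *\<^sub>C (f + g) = c *\<^sub>C f + c *\<^sub>C g" by transfer (simp add: scaleC_add_right)
  show "(c + d) *\<^sub>C f = c *\<^sub>C f + d *\<^sub>C f" by transfer (simp add: scaleC_add_left)
  show "c *\<^sub>C d *\<^sub>C f = (c * d) *\<^sub>C f" by transfer (simp add: scaleC_scaleC)
  show "r *\<^sub>R f = complex_of_real r *\<^sub>C f" by transfer (simp add: scaleR_scaleC)
  show "dist f g = norm (f - g)" by (rule dist_cblinfun_def)
  show "sgn f = inverse (norm f) *\<^sub>R f" by (rule sgn_cblinfun_def)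
  show "uniformity = (INF e\<in>{0 <..}. principal {(f, g :: ('a, 'b) cblinfun). dist f g < e})"
    by (rule uniformity_cblinfun_def)
  show "open S = (\<forall>f\<in>S. \<forall>\<^sub>F (f', g) in uniformity. f' = f \<longrightarrow> g \<in> S)"
    for S :: "('a, 'b) cblinfun set" by (rule open_cblinfun_def)
  show "(norm f = 0) = (f = 0)"
    by transfer (auto simp: bounded_clinear_def onorm_eq_0)
  show "norm (f + g) \<le> norm f + norm g"
    by transfer (simp add: bounded_clinear_def onorm_triangle)
  show "norm (r *\<^sub>R f) = \<bar>r\<bar> * norm f"
    by transfer (simp add: bounded_clinear_def onorm_scaleR)
  show "norm (c *\<^sub>C f) = cmod c * norm f"
    by transfer (simp add: bounded_clinear_def onorm_scaleC)
qed

end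

lemma bounded_clinear_cblinfun_apply: "bounded_clinear (cblinfun_apply f)"
  using cblinfun_apply by blast

lemma bounded_linear_cblinfun_apply: "bounded_linear (cblinfun_apply f)"
  using bounded_clinear_cblinfun_apply by (auto simp: bounded_clinear_def)

lemma norm_cblinfun: "norm (cblinfun_apply f x) \<le> norm f * norm x"
  by (simp add: norm_cblinfun.rep_eq onorm bounded_linear_cblinfun_apply)

instance cblinfun :: (complex_normed_vector, cbanach) cbanach
proof
  fix X :: "nat \<Rightarrow> ('a, 'b) cblinfun"
  assume X: "Cauchy X"
  define B where "B f = Blinfun (cblinfun_apply f)" for f :: "('a, 'b) cblinfun"
  have B_apply: "blinfun_apply (B f) = cblinfun_apply f" for f
    by (simp add: B_def bounded_linear_Blinfun_apply bounded_linear_cblinfun_apply)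
  have B_dist: "dist (B f) (B g) = dist f g" for f g
    by (simp add: dist_norm norm_blinfun.rep_eq norm_cblinfun.rep_eq minus_blinfun.rep_eq
        minus_cblinfun.rep_eq B_apply)
  have "Cauchy (\<lambda>n. B (X n))" using X by (simp add: Cauchy_def B_dist)
  then obtain L where L: "(\<lambda>n. B (X n)) \<longlonglongrightarrow> L"
    using Cauchy_convergent convergent_def by blast
  have pt: "(\<lambda>n. cblinfun_apply (X n) x) \<longlonglongrightarrow> blinfun_apply L x" for x
    using blinfun.tendsto[OF L tendsto_const[of x]] by (simp add: B_apply)
  have "blinfun_apply L (c *\<^sub>C x) = c *\<^sub>C blinfun_apply L x" for c x
  proof (rule LIMSEQ_unique[OF pt])
    have "cblinfun_apply (X n) (c *\<^sub>C x) = c *\<^sub>C cblinfun_apply (X n) x" for n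
      using bounded_clinear_cblinfun_apply[of "X n"] by (simp add: bounded_clinear_def)
    then show "(\<lambda>n. cblinfun_apply (X n) (c *\<^sub>C x)) \<longlonglongrightarrow> c *\<^sub>C blinfun_apply L x"
      using bounded_linear.tendsto[OF bounded_linear_scaleC pt] by simp
  qed
  then have "bounded_clinear (blinfun_apply L)"
    by (simp add: bounded_clinear_def blinfun.bounded_linear_right)
  then have "B (Cblinfun (blinfun_apply L)) = L"
    by (simp add: B_def Cblinfun_inverse blinfun_apply_inverse)
  then have "X \<longlonglongrightarrow> Cblinfun (blinfun_apply L)"
    using L by (metis (no_types, lifting) B_dist LIMSEQ_def)
  then show "convergent X" by (auto simp: convergent_def)
qed


section \<open>Holomorphic Lipschitz maps on the unit ball\<close>

text \<open>Holomorphy on an open set is complex Frechet differentiability at every point.\<close>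

definition holomorphic_map_on ::
    "('a::complex_normed_vector \<Rightarrow> 'b::complex_normed_vector) \<Rightarrow> 'a set \<Rightarrow> bool" where
  "holomorphic_map_on f S \<longleftrightarrow> (\<forall>x\<in>S. \<exists>D. bounded_clinear D \<and> (f has_derivative D) (at x))"

definition Lip :: "('x::cbanach \<Rightarrow> 'y::cbanach) \<Rightarrow> real" where
  "Lip f = Inf {C. C-lipschitz_on (ball 0 1) f}"

text \<open>A map defined on the open unit ball is encoded as the total function that
  vanishes off the ball, so that equality of total functions is equality on the ball.\<close>

definition HL0_set :: "('x::cbanach \<Rightarrow> 'y::cbanach) set" where
  "HL0_set = {f. holomorphic_map_on f (ball 0 1) \<and> (\<exists>C. C-lipschitz_on (ball 0 1) f) \<and>
     f 0 = 0 \<and> (\<forall>x. x \<notin> ball 0 1 \<longrightarrow> f x = 0)}"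

lemma Lip_lipschitz:
  assumes "\<exists>C. C-lipschitz_on (ball 0 1) f"
  shows "(Lip f)-lipschitz_on (ball 0 1) f"
proof (rule lipschitz_onI)
  let ?A = "{C. C-lipschitz_on (ball 0 1) f}"
  have ne: "?A \<noteq> {}" using assms by auto
  show "0 \<le> Lip f" unfolding Lip_def
    by (rule cInf_greatest[OF ne]) (auto dest: lipschitz_on_nonneg)
  fix x y :: 'a assume xy: "x \<in> ball 0 1" "y \<in> ball 0 1"
  show "dist (f x) (f y) \<le> Lip f * dist x y"
  proof (cases "x = y")
    case False
    have "dist (f x) (f y) / dist x y \<le> Lip f" unfolding Lip_def
    proof (rule cInf_greatest[OF ne])
      fix C assume "C \<in> ?A"
      then have "dist (f x) (f y) \<le> C * dist x y" using xy by (auto dest: lipschitz_onD)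
      then show "dist (f x) (f y) / dist x y \<le> C" using False by (simp add: divide_le_eq)
    qed
    then show ?thesis using False by (simp add: divide_le_eq)
  qed simp
qed

lemma Lip_le: "C-lipschitz_on (ball 0 1) f \<Longrightarrow> Lip f \<le> C"
  unfolding Lip_def by (rule cInf_lower) (auto intro: bdd_belowI[of _ 0] dest: lipschitz_on_nonneg)

lemma HL0_set_lipschitz: "f \<in> HL0_set \<Longrightarrow> (Lip f)-lipschitz_on (ball 0 1) f"
  by (rule Lip_lipschitz) (simp add: HL0_set_def)

lemma Lip_nonneg: "f \<in> HL0_set \<Longrightarrow> 0 \<le> Lip f"
  using HL0_set_lipschitz lipschitz_on_nonneg by blast

lemma HL0_set_zero: "(\<lambda>_. 0) \<in> HL0_set"
  by (auto simp: HL0_set_def holomorphic_map_on_def bounded_clinear_def scaleC_zero_right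
      lipschitz_on_def intro!: exI[of _ "\<lambda>_. 0"] exI[of _ "0::real"])

lemma Lip_add:
  assumes "f \<in> HL0_set" "g \<in> HL0_set"
  shows "(Lip f + Lip g)-lipschitz_on (ball 0 1) (\<lambda>x. f x + g x)"
  by (intro lipschitz_on_add HL0_set_lipschitz assms)

lemma HL0_set_add:
  assumes "f \<in> HL0_set" "g \<in> HL0_set"
  shows "(\<lambda>x. f x + g x) \<in> HL0_set"
proof -
  have "holomorphic_map_on (\<lambda>x. f x + g x) (ball 0 1)"
    unfolding holomorphic_map_on_def
  proof
    fix x :: 'a assume "x \<in> ball 0 1"
    with assms obtain D E where "bounded_clinear D" "(f has_derivative D) (at x)"
      "bounded_clinear E" "(g has_derivative E) (at x)"
      unfolding HL0_set_def holomorphic_map_on_def by blast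
    then show "\<exists>D. bounded_clinear D \<and> ((\<lambda>x. f x + g x) has_derivative D) (at x)"
      by (intro exI[of _ "\<lambda>h. D h + E h"])
        (auto simp: bounded_clinear_def scaleC_add_right intro: bounded_linear_add has_derivative_add)
  qed
  then show ?thesis using Lip_add[OF assms] assms by (auto simp: HL0_set_def)
qed

lemma Lip_scaleC_le:
  assumes "f \<in> HL0_set"
  shows "(cmod c * Lip f)-lipschitz_on (ball 0 1) (\<lambda>x. c *\<^sub>C f x)"
proof (rule lipschitz_onI)
  fix x y :: 'a assume "x \<in> ball 0 1" "y \<in> ball 0 1"
  then have "dist (f x) (f y) \<le> Lip f * dist x y"
    by (rule lipschitz_onD[OF HL0_set_lipschitz[OF assms]])
  then show "dist (c *\<^sub>C f x) (c *\<^sub>C f y) \<le> cmod c * Lip f * dist x y"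
    by (simp add: dist_norm norm_scaleC mult_left_mono mult.assoc flip: scaleC_diff_right)
qed (simp add: Lip_nonneg[OF assms])

lemma HL0_set_scaleC:
  assumes "f \<in> HL0_set"
  shows "(\<lambda>x. c *\<^sub>C f x) \<in> HL0_set"
proof -
  have "holomorphic_map_on (\<lambda>x. c *\<^sub>C f x) (ball 0 1)"
    unfolding holomorphic_map_on_def
  proof
    fix x :: 'a assume "x \<in> ball 0 1"
    with assms obtain D where "bounded_clinear D" "(f has_derivative D) (at x)"
      unfolding HL0_set_def holomorphic_map_on_def by blast
    then show "\<exists>D. bounded_clinear D \<and> ((\<lambda>x. c *\<^sub>C f x) has_derivative D) (at x)"
      by (intro exI[of _ "\<lambda>h. c *\<^sub>C D h"])
        (auto simp: bounded_clinear_def scaleC_scaleC mult.commute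
          intro: bounded_linear_compose[OF bounded_linear_scaleC]
            bounded_linear.has_derivative[OF bounded_linear_scaleC])
  qed
  then show ?thesis using Lip_scaleC_le[OF assms] assms
    by (auto simp: HL0_set_def scaleC_zero_right)
qed

lemma Lip_scaleC:
  assumes "f \<in> HL0_set"
  shows "Lip (\<lambda>x. c *\<^sub>C f x) = cmod c * Lip f"
proof (rule antisym)
  show "Lip (\<lambda>x. c *\<^sub>C f x) \<le> cmod c * Lip f" by (rule Lip_le[OF Lip_scaleC_le[OF assms]])
  show "cmod c * Lip f \<le> Lip (\<lambda>x. c *\<^sub>C f x)"
  proof (cases "c = 0")
    case True then show ?thesis using Lip_nonneg[OF HL0_set_scaleC[OF assms, of c]] by simp
  next
    case False
    have "Lip (\<lambda>x. inverse c *\<^sub>C c *\<^sub>C f x) \<le> cmod (inverse c) * Lip (\<lambda>x. c *\<^sub>C f x)"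
      by (rule Lip_le[OF Lip_scaleC_le[OF HL0_set_scaleC[OF assms]]])
    then show ?thesis using False by (simp add: scaleC_scaleC scaleC_one norm_divide norm_inverse field_simps)
  qed
qed

lemma HL0_set_scaleR: "f \<in> HL0_set \<Longrightarrow> (\<lambda>x. r *\<^sub>R f x) \<in> HL0_set"
  unfolding scaleR_scaleC by (rule HL0_set_scaleC)

lemma HL0_set_uminus: "f \<in> HL0_set \<Longrightarrow> (\<lambda>x. - f x) \<in> HL0_set"
  using HL0_set_scaleR[of f "- 1"] by simp

lemma HL0_set_diff: "f \<in> HL0_set \<Longrightarrow> g \<in> HL0_set \<Longrightarrow> (\<lambda>x. f x - g x) \<in> HL0_set"
  using HL0_set_add[of f "\<lambda>x. - g x"] by (simp add: HL0_set_uminus)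

lemma Lip_eq_0_iff:
  assumes "f \<in> HL0_set"
  shows "Lip f = 0 \<longleftrightarrow> f = (\<lambda>_. 0)"
proof
  assume L: "Lip f = 0"
  show "f = (\<lambda>_. 0)"
  proof
    fix x show "f x = 0"
    proof (cases "x \<in> ball 0 1")
      case True
      then show ?thesis
        using lipschitz_onD[OF HL0_set_lipschitz[OF assms] True, of 0] L assms
        by (simp add: HL0_set_def)
    qed (use assms in \<open>simp add: HL0_set_def\<close>)
  qed
next
  assume "f = (\<lambda>_. 0)"
  then show "Lip f = 0"
    using Lip_le[of 0 f] Lip_nonneg[OF assms] by (simp add: lipschitz_on_def)
qed

typedef (overloaded) ('x, 'y) HL0 = "HL0_set :: ('x::cbanach \<Rightarrow> 'y::cbanach) set"
  morphisms HL0_apply HL0_Abs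
  using HL0_set_zero by blast

setup_lifting type_definition_HL0

instantiation HL0 :: (cbanach, cbanach) complex_normed_vector
begin

lift_definition norm_HL0 :: "('a, 'b) HL0 \<Rightarrow> real" is Lip .

lift_definition zero_HL0 :: "('a, 'b) HL0" is "\<lambda>x. 0" by (rule HL0_set_zero)

lift_definition plus_HL0 :: "('a, 'b) HL0 \<Rightarrow> ('a, 'b) HL0 \<Rightarrow> ('a, 'b) HL0"
  is "\<lambda>f g x. f x + g x" by (rule HL0_set_add)

lift_definition minus_HL0 :: "('a, 'b) HL0 \<Rightarrow> ('a, 'b) HL0 \<Rightarrow> ('a, 'b) HL0"
  is "\<lambda>f g x. f x - g x" by (rule HL0_set_diff)

lift_definition uminus_HL0 :: "('a, 'b) HL0 \<Rightarrow> ('a, 'b) HL0"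
  is "\<lambda>f x. - f x" by (rule HL0_set_uminus)

lift_definition scaleR_HL0 :: "real \<Rightarrow> ('a, 'b) HL0 \<Rightarrow> ('a, 'b) HL0"
  is "\<lambda>r f x. r *\<^sub>R f x" by (rule HL0_set_scaleR)

lift_definition scaleC_HL0 :: "complex \<Rightarrow> ('a, 'b) HL0 \<Rightarrow> ('a, 'b) HL0"
  is "\<lambda>c f x. c *\<^sub>C f x" by (rule HL0_set_scaleC)

definition dist_HL0 :: "('a, 'b) HL0 \<Rightarrow> ('a, 'b) HL0 \<Rightarrow> real" where
  "dist_HL0 f g = norm (f - g)"

definition sgn_HL0 :: "('a, 'b) HL0 \<Rightarrow> ('a, 'b) HL0" where
  "sgn_HL0 f = inverse (norm f) *\<^sub>R f"

definition uniformity_HL0 :: "(('a, 'b) HL0 \<times> ('a, 'b) HL0) filter" where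
  "uniformity_HL0 = (INF e\<in>{0 <..}. principal {(f, g). dist f g < e})"

definition open_HL0 :: "('a, 'b) HL0 set \<Rightarrow> bool" where
  "open_HL0 S = (\<forall>f\<in>S. \<forall>\<^sub>F (f', g) in uniformity. f' = f \<longrightarrow> g \<in> S)"

instance
proof
  fix f g h :: "('a, 'b) HL0" and c d :: complex and r s :: real
  show "f + g + h = f + (g + h)" by transfer (simp add: add.assoc)
  show "f + g = g + f" by transfer (simp add: add.commute)
  show "0 + f = f" by transfer simp
  show "- f + f = 0" by transfer simp
  show "f - g = f + - g" by transfer simp
  show "r *\<^sub>R (f + g) = r *\<^sub>R f + r *\<^sub>R g" by transfer (simp add: scaleR_add_right)
  show "(r + s) *\<^sub>R f = r *\<^sub>R f + s *\<^sub>R f" by transfer (simp add: scaleR_add_left)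
  show "r *\<^sub>R s *\<^sub>R f = (r * s) *\<^sub>R f" by transfer simp
  show "1 *\<^sub>R f = f" by transfer simp
  show "c *\<^sub>C (f + g) = c *\<^sub>C f + c *\<^sub>C g" by transfer (simp add: scaleC_add_right)
  show "(c + d) *\<^sub>C f = c *\<^sub>C f + d *\<^sub>C f" by transfer (simp add: scaleC_add_left)
  show "c *\<^sub>C d *\<^sub>C f = (c * d) *\<^sub>C f" by transfer (simp add: scaleC_scaleC)
  show sc: "r *\<^sub>R f = complex_of_real r *\<^sub>C f" by transfer (simp add: scaleR_scaleC)
  show "dist f g = norm (f - g)" by (rule dist_HL0_def)
  show "sgn f = inverse (norm f) *\<^sub>R f" by (rule sgn_HL0_def)
  show "uniformity = (INF e\<in>{0 <..}. principal {(f, g :: ('a, 'b) HL0). dist f g < e})"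
    by (rule uniformity_HL0_def)
  show "open S = (\<forall>f\<in>S. \<forall>\<^sub>F (f', g) in uniformity. f' = f \<longrightarrow> g \<in> S)"
    for S :: "('a, 'b) HL0 set" by (rule open_HL0_def)
  show "(norm f = 0) = (f = 0)" by transfer (rule Lip_eq_0_iff)
  show "norm (f + g) \<le> norm f + norm g" by transfer (rule Lip_le[OF Lip_add])
  have nC: "norm (c *\<^sub>C f) = cmod c * norm f" for c by transfer (rule Lip_scaleC)
  then show "norm (c *\<^sub>C f) = cmod c * norm f" .
  show "norm (r *\<^sub>R f) = \<bar>r\<bar> * norm f" by (simp add: sc nC)
qed

end


section \<open>The compact-open topology and the predual\<close>

definition tau0 :: "('x::cbanach, 'y::cbanach) HL0 topology" where
  "tau0 = topology (\<lambda>U. \<forall>f\<in>U. \<exists>K e. compact K \<and> K \<subseteq> ball 0 1 \<and> e > 0 \<and>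
     {g. \<forall>x\<in>K. norm (HL0_apply g x - HL0_apply f x) < e} \<subseteq> U)"

lemma openin_tau0:
  "openin tau0 U \<longleftrightarrow> (\<forall>f\<in>U. \<exists>K e. compact K \<and> K \<subseteq> ball 0 1 \<and> e > 0 \<and>
     {g. \<forall>x\<in>K. norm (HL0_apply g x - HL0_apply f x) < e} \<subseteq> U)"
proof -
  let ?n = "\<lambda>f K e. {g :: ('a, 'b) HL0. \<forall>x\<in>K. norm (HL0_apply g x - HL0_apply f x) < e}"
  let ?P = "\<lambda>U. \<forall>f\<in>U. \<exists>K e. compact K \<and> K \<subseteq> ball 0 1 \<and> e > 0 \<and> ?n f K e \<subseteq> U"
  have "?P (S \<inter> T)" if S: "?P S" and T: "?P T" for S T
  proof
    fix f assume f: "f \<in> S \<inter> T"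
    obtain K e where 1: "compact K" "K \<subseteq> ball 0 1" "e > 0" "?n f K e \<subseteq> S"
      using bspec[OF S IntD1[OF f]] by (elim exE conjE)
    obtain L d where 2: "compact L" "L \<subseteq> ball 0 1" "d > 0" "?n f L d \<subseteq> T"
      using bspec[OF T IntD2[OF f]] by (elim exE conjE)
    have "?n f (K \<union> L) (min e d) \<subseteq> ?n f K e \<inter> ?n f L d" by auto
    then have "?n f (K \<union> L) (min e d) \<subseteq> S \<inter> T" using 1(4) 2(4) by blast
    moreover have "compact (K \<union> L)" "K \<union> L \<subseteq> ball 0 1" "min e d > 0"
      using 1 2 by (auto intro: compact_Un)
    ultimately show "\<exists>K e. compact K \<and> K \<subseteq> ball 0 1 \<and> e > 0 \<and> ?n f K e \<subseteq> S \<inter> T" by blast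
  qed
  moreover have "?P (\<Union>\<K>)" if \<K>: "\<forall>S\<in>\<K>. ?P S" for \<K>
  proof
    fix f assume "f \<in> \<Union>\<K>"
    then obtain S where S: "S \<in> \<K>" "f \<in> S" by blast
    then obtain K e where "compact K" "K \<subseteq> ball 0 1" "e > 0" "?n f K e \<subseteq> S"
      using bspec[OF bspec[OF \<K> S(1)] S(2)] by (elim exE conjE)
    then show "\<exists>K e. compact K \<and> K \<subseteq> ball 0 1 \<and> e > 0 \<and> ?n f K e \<subseteq> \<Union>\<K>"
      using Union_upper[OF S(1)] by (intro exI[of _ K] exI[of _ e] conjI) (assumption | erule (1) subset_trans)+
  qed
  ultimately have "istopology ?P" unfolding istopology_def by blast
  then show ?thesis unfolding tau0_def by (simp add: topology_inverse')
qed

lemma topspace_tau0 [simp]: "topspace tau0 = UNIV"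
proof -
  have "openin tau0 (UNIV :: ('a, 'b) HL0 set)"
    unfolding openin_tau0 by (auto intro!: exI[of _ "{}"] exI[of _ "1::real"])
  then show ?thesis by (metis openin_subset top.extremum_uniqueI)
qed

lemma HL0_apply_lipschitz: "(norm f)-lipschitz_on (ball 0 1) (HL0_apply f)"
  by transfer (rule HL0_set_lipschitz)

lemma openin_tau0_nbhd:
  fixes f :: "('x::cbanach, 'y::cbanach) HL0"
  assumes K: "compact K" "K \<subseteq> ball 0 1"
  shows "openin tau0 {g. \<forall>x\<in>K. norm (HL0_apply g x - HL0_apply f x) < e}" (is "openin _ ?U")
  unfolding openin_tau0
proof
  fix g assume g: "g \<in> ?U"
  show "\<exists>K' d. compact K' \<and> K' \<subseteq> ball 0 1 \<and> d > 0 \<and>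
      {h. \<forall>x\<in>K'. norm (HL0_apply h x - HL0_apply g x) < d} \<subseteq> ?U"
  proof (cases "K = {}")
    case True
    then show ?thesis by (auto intro!: exI[of _ "{}"] exI[of _ "1::real"])
  next
    case False
    have c: "continuous_on K (HL0_apply h)" for h :: "('x, 'y) HL0"
      using lipschitz_on_continuous_on[OF HL0_apply_lipschitz] K(2) continuous_on_subset by blast
    have "continuous_on K (\<lambda>x. norm (HL0_apply g x - HL0_apply f x))"
      by (intro continuous_intros c)
    then obtain y where y: "y \<in> K"
      "\<And>x. x \<in> K \<Longrightarrow> norm (HL0_apply g x - HL0_apply f x) \<le> norm (HL0_apply g y - HL0_apply f y)"
      using continuous_attains_sup[OF K(1) False] by blast
    define d where "d = e - norm (HL0_apply g y - HL0_apply f y)"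
    have "d > 0" using g y(1) by (simp add: d_def)
    moreover have "h \<in> ?U" if h: "\<forall>x\<in>K. norm (HL0_apply h x - HL0_apply g x) < d" for h
    proof safe
      fix x assume x: "x \<in> K"
      have "norm (HL0_apply h x - HL0_apply f x)
          \<le> norm (HL0_apply h x - HL0_apply g x) + norm (HL0_apply g x - HL0_apply f x)"
        using norm_triangle_ineq[of "HL0_apply h x - HL0_apply g x" "HL0_apply g x - HL0_apply f x"]
        by simp
      then show "norm (HL0_apply h x - HL0_apply f x) < e"
        using h x y(2)[OF x] by (auto simp: d_def)
    qed
    ultimately show ?thesis using K by blast
  qed
qed

definition tau0_continuous :: "(('x::cbanach, complex) HL0, complex) cblinfun \<Rightarrow> bool" where
  "tau0_continuous \<phi> \<longleftrightarrow>
     continuous_map (subtopology tau0 {f. norm f \<le> 1}) euclidean (cblinfun_apply \<phi>)"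

lemma tau0_continuous_iff:
  "tau0_continuous \<phi> \<longleftrightarrow> (\<forall>f e. norm f \<le> 1 \<longrightarrow> e > 0 \<longrightarrow>
     (\<exists>K d. compact K \<and> K \<subseteq> ball 0 1 \<and> d > 0 \<and>
        (\<forall>g. norm g \<le> 1 \<longrightarrow> (\<forall>x\<in>K. norm (HL0_apply g x - HL0_apply f x) < d) \<longrightarrow>
           norm (cblinfun_apply \<phi> g - cblinfun_apply \<phi> f) < e)))" (is "_ \<longleftrightarrow> ?R")
proof
  assume L: "tau0_continuous \<phi>"
  show ?R
  proof (intro allI impI)
    fix f :: "('a, complex) HL0" and e :: real
    assume f: "norm f \<le> 1" and e: "e > 0"
    have "openin (subtopology tau0 {f. norm f \<le> 1})
        {g \<in> {f. norm f \<le> 1}. cblinfun_apply \<phi> g \<in> ball (cblinfun_apply \<phi> f) e}"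
      using openin_continuous_map_preimage[OF L[unfolded tau0_continuous_def],
          of "ball (cblinfun_apply \<phi> f) e"] by (simp add: topspace_subtopology)
    then obtain T where T: "openin tau0 T"
      "{g \<in> {f. norm f \<le> 1}. cblinfun_apply \<phi> g \<in> ball (cblinfun_apply \<phi> f) e} = T \<inter> {f. norm f \<le> 1}"
      by (auto simp: openin_subtopology)
    have "f \<in> T" using T(2) f e by fastforce
    then obtain K d where K: "compact K" "K \<subseteq> ball 0 1" "d > 0"
      "{g. \<forall>x\<in>K. norm (HL0_apply g x - HL0_apply f x) < d} \<subseteq> T"
      using T(1) unfolding openin_tau0 by meson
    have "norm (cblinfun_apply \<phi> g - cblinfun_apply \<phi> f) < e"
      if "norm g \<le> 1" "\<forall>x\<in>K. norm (HL0_apply g x - HL0_apply f x) < d" for g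
    proof -
      have "g \<in> T \<inter> {f. norm f \<le> 1}" using K(4) that by blast
      then have "cblinfun_apply \<phi> g \<in> ball (cblinfun_apply \<phi> f) e" using T(2) by blast
      then show ?thesis by (simp add: dist_norm norm_minus_commute)
    qed
    then show "\<exists>K d. compact K \<and> K \<subseteq> ball 0 1 \<and> d > 0 \<and>
        (\<forall>g. norm g \<le> 1 \<longrightarrow> (\<forall>x\<in>K. norm (HL0_apply g x - HL0_apply f x) < d) \<longrightarrow>
           norm (cblinfun_apply \<phi> g - cblinfun_apply \<phi> f) < e)"
      using K(1-3) by blast
  qed
next
  assume R: ?R
  have "openin (subtopology tau0 {f. norm f \<le> 1}) {f \<in> {f. norm f \<le> 1}. cblinfun_apply \<phi> f \<in> U}"
    if U: "open U" for U
  proof (rule iffD2[OF openin_subopen], rule ballI)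
    fix f assume "f \<in> {f \<in> {f. norm f \<le> 1}. cblinfun_apply \<phi> f \<in> U}"
    then have f: "norm f \<le> 1" "cblinfun_apply \<phi> f \<in> U" by simp_all
    then obtain e where e: "e > 0" "ball (cblinfun_apply \<phi> f) e \<subseteq> U"
      using U open_contains_ball by blast
    then obtain K d where K: "compact K" "K \<subseteq> ball 0 1" "d > 0"
      and c: "\<And>g. norm g \<le> 1 \<Longrightarrow> (\<forall>x\<in>K. norm (HL0_apply g x - HL0_apply f x) < d) \<Longrightarrow>
           norm (cblinfun_apply \<phi> g - cblinfun_apply \<phi> f) < e"
      using R[rule_format, OF f(1) e(1)] by (elim exE conjE) blast
    let ?N = "{g. \<forall>x\<in>K. norm (HL0_apply g x - HL0_apply f x) < d}"
    have "openin (subtopology tau0 {f. norm f \<le> 1}) (?N \<inter> {f. norm f \<le> 1})"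
      using openin_tau0_nbhd[OF K(1,2)] by (rule openin_subtopology_Int)
    moreover have "f \<in> ?N \<inter> {f. norm f \<le> 1}" using f K(3) by simp
    moreover have "?N \<inter> {f. norm f \<le> 1} \<subseteq> {f \<in> {f. norm f \<le> 1}. cblinfun_apply \<phi> f \<in> U}"
    proof
      fix g assume g: "g \<in> ?N \<inter> {f. norm f \<le> 1}"
      then have "norm (cblinfun_apply \<phi> g - cblinfun_apply \<phi> f) < e" using c by simp
      then have "cblinfun_apply \<phi> g \<in> ball (cblinfun_apply \<phi> f) e"
        by (simp add: dist_norm norm_minus_commute)
      then show "g \<in> {f \<in> {f. norm f \<le> 1}. cblinfun_apply \<phi> f \<in> U}" using e(2) g by blast
    qed
    ultimately show "\<exists>T. openin (subtopology tau0 {f. norm f \<le> 1}) T \<and> f \<in> T \<and>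
        T \<subseteq> {f \<in> {f. norm f \<le> 1}. cblinfun_apply \<phi> f \<in> U}" by blast
  qed
  then show "tau0_continuous \<phi>"
    unfolding tau0_continuous_def continuous_map_def by (simp add: topspace_subtopology)
qed

lemma tau0_continuous_zero: "tau0_continuous 0"
  by (simp add: tau0_continuous_def zero_cblinfun.rep_eq)

lemma tau0_continuous_add: "tau0_continuous \<phi> \<Longrightarrow> tau0_continuous \<psi> \<Longrightarrow> tau0_continuous (\<phi> + \<psi>)"
  unfolding tau0_continuous_def plus_cblinfun.rep_eq by (rule continuous_map_add)

lemma tau0_continuous_scaleC:
  assumes "tau0_continuous \<phi>"
  shows "tau0_continuous (c *\<^sub>C \<phi>)"
proof -
  have "continuous_map euclidean euclidean (\<lambda>z. c * z)"
    by (simp add: continuous_on_mult_left)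
  from continuous_map_compose[OF assms[unfolded tau0_continuous_def] this] show ?thesis
    by (simp add: tau0_continuous_def scaleC_cblinfun.rep_eq scaleC_complex_def o_def)
qed

lemma tau0_continuous_scaleR: "tau0_continuous \<phi> \<Longrightarrow> tau0_continuous (r *\<^sub>R \<phi>)"
  unfolding scaleR_scaleC by (rule tau0_continuous_scaleC)

lemma tau0_continuous_uminus: "tau0_continuous \<phi> \<Longrightarrow> tau0_continuous (- \<phi>)"
  using tau0_continuous_scaleR[of \<phi> "- 1"] by simp

lemma tau0_continuous_diff: "tau0_continuous \<phi> \<Longrightarrow> tau0_continuous \<psi> \<Longrightarrow> tau0_continuous (\<phi> - \<psi>)"
  using tau0_continuous_add[of \<phi> "- \<psi>"] by (simp add: tau0_continuous_uminus)

lemma tau0_continuous_limit: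
  assumes X: "\<And>n. tau0_continuous (X n)" and lim: "X \<longlonglongrightarrow> \<phi>"
  shows "tau0_continuous \<phi>"
  unfolding tau0_continuous_iff
proof (intro allI impI)
  fix f :: "('a, complex) HL0" and e :: real
  assume f: "norm f \<le> 1" and e: "e > 0"
  then have "e / 3 > 0" by simp
  with lim obtain n where n: "norm (X n - \<phi>) < e / 3"
    unfolding LIMSEQ_iff by (meson order_refl)
  have close: "norm (cblinfun_apply (X n) g - cblinfun_apply \<phi> g) < e / 3" if "norm g \<le> 1" for g
  proof -
    have "norm (cblinfun_apply (X n) g - cblinfun_apply \<phi> g) \<le> norm (X n - \<phi>) * norm g"
      using norm_cblinfun[of "X n - \<phi>" g] by (simp add: minus_cblinfun.rep_eq)
    also have "\<dots> \<le> norm (X n - \<phi>) * 1" using that by (intro mult_left_mono) auto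
    finally show ?thesis using n by simp
  qed
  obtain K d where K: "compact K" "K \<subseteq> ball 0 1" "d > 0"
    and c: "\<And>g. norm g \<le> 1 \<Longrightarrow> (\<forall>x\<in>K. norm (HL0_apply g x - HL0_apply f x) < d) \<Longrightarrow>
         norm (cblinfun_apply (X n) g - cblinfun_apply (X n) f) < e / 3"
    using X[of n, unfolded tau0_continuous_iff, rule_format, OF f \<open>e / 3 > 0\<close>]
    by (elim exE conjE) blast
  have "norm (cblinfun_apply \<phi> g - cblinfun_apply \<phi> f) < e"
    if g: "norm g \<le> 1" "\<forall>x\<in>K. norm (HL0_apply g x - HL0_apply f x) < d" for g
  unfolding dist_norm[symmetric]
  proof (rule dist_triangle_third)
    show "dist (cblinfun_apply \<phi> g) (cblinfun_apply (X n) g) < e / 3"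
      using close[OF g(1)] by (simp add: dist_norm norm_minus_commute)
    show "dist (cblinfun_apply (X n) g) (cblinfun_apply (X n) f) < e / 3"
      using c[OF g] by (simp add: dist_norm)
    show "dist (cblinfun_apply (X n) f) (cblinfun_apply \<phi> f) < e / 3"
      using close[OF f] by (simp add: dist_norm)
  qed
  then show "\<exists>K d. compact K \<and> K \<subseteq> ball 0 1 \<and> d > 0 \<and>
        (\<forall>g. norm g \<le> 1 \<longrightarrow> (\<forall>x\<in>K. norm (HL0_apply g x - HL0_apply f x) < d) \<longrightarrow>
           norm (cblinfun_apply \<phi> g - cblinfun_apply \<phi> f) < e)"
    using K by blast
qed

typedef (overloaded) 'x G0 =
  "{\<phi> :: (('x::cbanach, complex) HL0, complex) cblinfun. tau0_continuous \<phi>}"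
  morphisms G0_functional G0_Abs
  using tau0_continuous_zero by blast

setup_lifting type_definition_G0

instantiation G0 :: (cbanach) complex_normed_vector
begin

lift_definition norm_G0 :: "'a G0 \<Rightarrow> real" is norm .
lift_definition zero_G0 :: "'a G0" is 0 by (rule tau0_continuous_zero)
lift_definition plus_G0 :: "'a G0 \<Rightarrow> 'a G0 \<Rightarrow> 'a G0" is "(+)" by (rule tau0_continuous_add)
lift_definition minus_G0 :: "'a G0 \<Rightarrow> 'a G0 \<Rightarrow> 'a G0" is "(-)" by (rule tau0_continuous_diff)
lift_definition uminus_G0 :: "'a G0 \<Rightarrow> 'a G0" is uminus by (rule tau0_continuous_uminus)
lift_definition scaleR_G0 :: "real \<Rightarrow> 'a G0 \<Rightarrow> 'a G0" is scaleR by (rule tau0_continuous_scaleR)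
lift_definition scaleC_G0 :: "complex \<Rightarrow> 'a G0 \<Rightarrow> 'a G0" is scaleC by (rule tau0_continuous_scaleC)

definition dist_G0 :: "'a G0 \<Rightarrow> 'a G0 \<Rightarrow> real" where
  "dist_G0 \<phi> \<psi> = norm (\<phi> - \<psi>)"

definition sgn_G0 :: "'a G0 \<Rightarrow> 'a G0" where
  "sgn_G0 \<phi> = inverse (norm \<phi>) *\<^sub>R \<phi>"

definition uniformity_G0 :: "('a G0 \<times> 'a G0) filter" where
  "uniformity_G0 = (INF e\<in>{0 <..}. principal {(\<phi>, \<psi>). dist \<phi> \<psi> < e})"

definition open_G0 :: "'a G0 set \<Rightarrow> bool" where
  "open_G0 S = (\<forall>\<phi>\<in>S. \<forall>\<^sub>F (\<phi>', \<psi>) in uniformity. \<phi>' = \<phi> \<longrightarrow> \<psi> \<in> S)"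

instance
proof
  fix f g h :: "'a G0" and c d :: complex and r s :: real
  show "f + g + h = f + (g + h)" by transfer (simp add: add.assoc)
  show "f + g = g + f" by transfer (simp add: add.commute)
  show "0 + f = f" by transfer simp
  show "- f + f = 0" by transfer simp
  show "f - g = f + - g" by transfer simp
  show "r *\<^sub>R (f + g) = r *\<^sub>R f + r *\<^sub>R g" by transfer (simp add: scaleR_add_right)
  show "(r + s) *\<^sub>R f = r *\<^sub>R f + s *\<^sub>R f" by transfer (simp add: scaleR_add_left)
  show "r *\<^sub>R s *\<^sub>R f = (r * s) *\<^sub>R f" by transfer simp
  show "1 *\<^sub>R f = f" by transfer simp
  show "c *\<^sub>C (f + g) = c *\<^sub>C f + c *\<^sub>C g" by transfer (simp add: scaleC_add_right)
  show "(c + d) *\<^sub>C f = c *\<^sub>C f + d *\<^sub>C f" by transfer (simp add: scaleC_add_left)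
  show "c *\<^sub>C d *\<^sub>C f = (c * d) *\<^sub>C f" by transfer (simp add: scaleC_scaleC)
  show "r *\<^sub>R f = complex_of_real r *\<^sub>C f" by transfer (simp add: scaleR_scaleC)
  show "dist f g = norm (f - g)" by (rule dist_G0_def)
  show "sgn f = inverse (norm f) *\<^sub>R f" by (rule sgn_G0_def)
  show "uniformity = (INF e\<in>{0 <..}. principal {(f, g :: 'a G0). dist f g < e})"
    by (rule uniformity_G0_def)
  show "open S = (\<forall>f\<in>S. \<forall>\<^sub>F (f', g) in uniformity. f' = f \<longrightarrow> g \<in> S)"
    for S :: "'a G0 set" by (rule open_G0_def)
  show "(norm f = 0) = (f = 0)" by transfer simp
  show "norm (f + g) \<le> norm f + norm g" by transfer (rule norm_triangle_ineq)
  show "norm (r *\<^sub>R f) = \<bar>r\<bar> * norm f" by transfer simp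
  show "norm (c *\<^sub>C f) = cmod c * norm f" by transfer (rule norm_scaleC)
qed

end

instance G0 :: (cbanach) cbanach
proof
  fix X :: "nat \<Rightarrow> 'a G0"
  assume X: "Cauchy X"
  have d: "dist (G0_functional \<phi>) (G0_functional \<psi>) = dist \<phi> \<psi>" for \<phi> \<psi> :: "'a G0"
    by (simp add: dist_norm norm_G0.rep_eq minus_G0.rep_eq)
  have "Cauchy (\<lambda>n. G0_functional (X n))" using X by (simp add: Cauchy_def d)
  then obtain L where L: "(\<lambda>n. G0_functional (X n)) \<longlonglongrightarrow> L"
    using Cauchy_convergent convergent_def by blast
  have "tau0_continuous (G0_functional (X n))" for n using G0_functional by blast
  then have "tau0_continuous L" using L by (rule tau0_continuous_limit)
  then have "G0_functional (G0_Abs L) = L" by (simp add: G0_Abs_inverse)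
  then have "X \<longlonglongrightarrow> G0_Abs L"
    using L by (metis (no_types, lifting) d LIMSEQ_def)
  then show "convergent X" by (auto simp: convergent_def)
qed

definition G0_apply :: "'x::cbanach G0 \<Rightarrow> ('x, complex) HL0 \<Rightarrow> complex" where
  "G0_apply \<phi> = cblinfun_apply (G0_functional \<phi>)"


section \<open>Evaluation functionals\<close>

lemma norm_HL0_apply_le: "norm (HL0_apply f x) \<le> norm f * norm x"
proof (cases "x \<in> ball 0 1")
  case True
  have "HL0_apply f 0 = 0" by transfer (simp add: HL0_set_def)
  then show ?thesis using lipschitz_onD[OF HL0_apply_lipschitz True, of 0 f] by simp
next
  case False
  then have "HL0_apply f x = 0" by transfer (simp add: HL0_set_def)
  then show ?thesis by simp
qed

lift_definition evaluation :: "'x::cbanach \<Rightarrow> (('x, complex) HL0, complex) cblinfun"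
  is "\<lambda>x f. HL0_apply f x"
proof -
  fix x :: 'x
  have "bounded_linear (\<lambda>f :: ('x, complex) HL0. HL0_apply f x)"
    by (rule bounded_linear_intro[where K = "norm x"])
      (simp_all add: plus_HL0.rep_eq scaleR_HL0.rep_eq norm_HL0_apply_le)
  then show "bounded_clinear (\<lambda>f :: ('x, complex) HL0. HL0_apply f x)"
    by (simp add: bounded_clinear_def scaleC_HL0.rep_eq)
qed

lemma tau0_continuous_evaluation: "tau0_continuous (evaluation x)"
proof (cases "x \<in> ball 0 1")
  case True
  then show ?thesis unfolding tau0_continuous_iff evaluation.rep_eq
    by (auto intro!: exI[of _ "{x}"])
next
  case False
  then have "HL0_apply f x = 0" for f :: "('a, complex) HL0" by transfer (simp add: HL0_set_def)
  then show ?thesis by (simp add: tau0_continuous_def evaluation.rep_eq)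
qed

text \<open>Off the open unit ball this is the zero functional, in line with the encoding of
  maps on the ball as total functions.\<close>

lift_definition delta :: "'x::cbanach \<Rightarrow> 'x G0" is evaluation
  by (rule tau0_continuous_evaluation)

lemma G0_apply_delta: "G0_apply (delta x) f = HL0_apply f x"
  by (simp add: G0_apply_def delta.rep_eq evaluation.rep_eq)


section \<open>Linearization\<close>

definition linearizes ::
    "('x::cbanach \<Rightarrow> 'z::cbanach) \<Rightarrow> ('x, 'y::cbanach) HL0 \<Rightarrow> ('z, 'y) cblinfun \<Rightarrow> bool" where
  "linearizes d f T \<longleftrightarrow> (\<forall>x\<in>ball 0 1. cblinfun_apply T (d x) = HL0_apply f x)"

text \<open>The universal property of \<open>d\<close> for one fixed target space. Higher-order logic has no
  quantification over types inside formulas, hence the target is passed as a type argument.\<close>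

definition universal_for :: "'y::cbanach itself \<Rightarrow> ('x::cbanach \<Rightarrow> 'z::cbanach) \<Rightarrow> bool" where
  "universal_for TY d \<longleftrightarrow>
     (\<forall>f :: ('x, 'y) HL0. \<exists>!T :: ('z, 'y) cblinfun. linearizes d f T) \<and>
     isometric_isomorphism (\<lambda>f :: ('x, 'y) HL0. THE T :: ('z, 'y) cblinfun. linearizes d f T)"


section \<open>Weak-star convergence of nets\<close>

definition weak_star :: "('x::cbanach, complex) HL0 topology" where
  "weak_star = topology_generated_by {(\<lambda>f. G0_apply \<phi> f) -` U | \<phi> U. open U}"

definition directed :: "'i set \<Rightarrow> ('i \<Rightarrow> 'i \<Rightarrow> bool) \<Rightarrow> bool" where
  "directed I le \<longleftrightarrow> I \<noteq> {} \<and> reflp_on I le \<and> transp_on I le \<and>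
     (\<forall>a\<in>I. \<forall>b\<in>I. \<exists>c\<in>I. le a c \<and> le b c)"

definition tail_filter :: "'i set \<Rightarrow> ('i \<Rightarrow> 'i \<Rightarrow> bool) \<Rightarrow> 'i filter" where
  "tail_filter I le = (INF a\<in>I. principal {b\<in>I. le a b})"

lemma eventually_tail_filter:
  assumes "directed I le"
  shows "eventually P (tail_filter I le) \<longleftrightarrow> (\<exists>a\<in>I. \<forall>b\<in>I. le a b \<longrightarrow> P b)"
proof -
  have "eventually P (tail_filter I le) \<longleftrightarrow> (\<exists>a\<in>I. eventually P (principal {b\<in>I. le a b}))"
    unfolding tail_filter_def
  proof (rule eventually_INF_base)
    show "I \<noteq> {}" using assms by (simp add: directed_def)
    fix a b assume ab: "a \<in> I" "b \<in> I"
    then obtain c where c: "c \<in> I" "le a c" "le b c" using assms unfolding directed_def by blast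
    have "{x \<in> I. le c x} \<subseteq> {x \<in> I. le a x} \<inter> {x \<in> I. le b x}"
      using assms ab c unfolding directed_def by (blast dest: transp_onD)
    then show "\<exists>c\<in>I. principal {x \<in> I. le c x}
        \<le> inf (principal {x \<in> I. le a x}) (principal {x \<in> I. le b x})"
      using c(1) by auto
  qed
  then show ?thesis by (auto simp: eventually_principal)
qed

end

theory Submission
  imports Defs "HOL-Complex_Analysis.Conformal_Mappings"
begin

text \<open>
Everything rests on two facts about the evaluation functionals on the holomorphic Lipschitz
functions: the map \<open>delta\<close> is a holomorphic isometric embedding of the ball, and its image has dense
span in the predual.

Density (\<open>delta_span_dense\<close>) holds for the following reason. A functional \<open>\<phi>\<close> that is
continuous for uniform convergence on compact sets is small on all functions of Lipschitz constant \<open>1\<close> which vanish on a suitable finite set \<open>S\<close>. By Hahn-Banach its restriction to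
the functions vanishing on \<open>S\<close> extends to a small functional \<open>\<psi>\<close>, and the difference \<open>\<phi> - \<psi>\<close> annihilates
the common kernel of finitely many evaluations, so it is a combination of them.

Holomorphy (\<open>delta_has_derivative\<close>) comes from a second-order Taylor estimate whose constant is the
same for all functions of Lipschitz constant at most \<open>1\<close> (\<open>HL0_second_order_estimate\<close>); on complex
lines it is an instance of the Schwarz lemma. The isometry needs a functional norming \<open>x - y\<close>, again
from Hahn-Banach.

The linearization of a map \<open>f\<close> with values in \<open>Y\<close> sends \<open>\<phi>\<close> to the vector \<open>y\<close> with
\<open>F y = \<phi> (F \<circ> f)\<close> for all bounded functionals \<open>F\<close> on \<open>Y\<close>. Such a vector exists for evaluations, namely
\<open>f x\<close>, and satisfies \<open>norm y \<le> norm f * norm \<phi>\<close>, so by density and completeness it exists for every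
\<open>\<phi>\<close>. Uniqueness of the predual is then formal, and the description of bounded weak-star convergence
is density once more.
\<close>

section \<open>The Hahn-Banach theorem for sublinear functionals\<close>

definition sublinear :: "('a::real_vector \<Rightarrow> real) \<Rightarrow> bool" where
  "sublinear p \<longleftrightarrow> (\<forall>x y. p (x + y) \<le> p x + p y) \<and> (\<forall>r\<ge>0. \<forall>x. p (r *\<^sub>R x) = r * p x)"

lemma sublinear_add: "sublinear p \<Longrightarrow> p (x + y) \<le> p x + p y"
  and sublinear_scaleR: "sublinear p \<Longrightarrow> r \<ge> 0 \<Longrightarrow> p (r *\<^sub>R x) = r * p x"
  by (auto simp: sublinear_def)

lemma sublinear_0: "sublinear p \<Longrightarrow> p 0 = 0"
  using sublinear_scaleR[of p 0 0] by simp

lemma sublinear_uminus_le: "sublinear p \<Longrightarrow> - p (- x) \<le> p x"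
  using sublinear_add[of p x "- x"] sublinear_0[of p] by simp

lemma sublinearI:
  assumes add: "\<And>x y. p (x + y) \<le> p x + p y" and zero: "p 0 = 0"
    and scale: "\<And>r x. r > 0 \<Longrightarrow> p (r *\<^sub>R x) \<le> r * p x"
  shows "sublinear p"
proof -
  have "p (r *\<^sub>R x) = r * p x" if "r \<ge> 0" for r x
  proof (cases "r = 0")
    case False
    with that have r: "r > 0" by simp
    have "p x \<le> inverse r * p (r *\<^sub>R x)"
      using scale[of "inverse r" "r *\<^sub>R x"] r by simp
    then have "r * p x \<le> p (r *\<^sub>R x)" using r by (simp add: field_simps)
    with scale[OF r, of x] show ?thesis by simp
  qed (simp add: zero)
  with add show ?thesis by (simp add: sublinear_def)
qed

text \<open>The functional \<open>x \<mapsto> inf {q (x + m) - g m | m \<in> K}\<close> does it: taking \<open>m = 0\<close> puts it below \<open>q\<close>,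
taking \<open>x = - m\<close> gives the last estimate, and \<open>g \<le> q\<close> on the cone keeps the infimum finite. With
\<open>K\<close> a subspace this builds the domination of an extension of \<open>g\<close> into the majorant; with \<open>K\<close> a ray
it shows that minimal sublinear functionals are linear.\<close>

lemma sublinear_below_on_cone:
  fixes q :: "'a::real_vector \<Rightarrow> real"
  assumes q: "sublinear q"
    and K: "0 \<in> K" "\<And>m n. m \<in> K \<Longrightarrow> n \<in> K \<Longrightarrow> m + n \<in> K"
      "\<And>r m. r > 0 \<Longrightarrow> m \<in> K \<Longrightarrow> r *\<^sub>R m \<in> K"
    and g: "g 0 = 0" "\<And>m n. m \<in> K \<Longrightarrow> n \<in> K \<Longrightarrow> g (m + n) = g m + g n"
      "\<And>r m. r > 0 \<Longrightarrow> m \<in> K \<Longrightarrow> g (r *\<^sub>R m) = r * g m"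
    and le: "\<And>m. m \<in> K \<Longrightarrow> g m \<le> q m"
  obtains q' where "sublinear q'" "\<And>x. q' x \<le> q x" "\<And>m. m \<in> K \<Longrightarrow> q' (- m) \<le> - g m"
proof -
  define q' where "q' x = (INF m\<in>K. q (x + m) - g m)" for x
  have lower: "- q (- x) \<le> q (x + m) - g m" if "m \<in> K" for x m
    using sublinear_add[OF q, of "x + m" "- x"] le[OF that] by simp
  have upper: "q' x \<le> q (x + m) - g m" if "m \<in> K" for x m
    unfolding q'_def using lower that by (intro cINF_lower bdd_belowI[of _ "- q (- x)"]) auto
  have greatest: "c \<le> q' x" if "\<And>m. m \<in> K \<Longrightarrow> c \<le> q (x + m) - g m" for c x
    unfolding q'_def using K(1) that by (intro cINF_greatest) auto
  have "sublinear q'"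
  proof (rule sublinearI)
    fix x y
    have "q' (x + y) - (q (y + n) - g n) \<le> q' x" if n: "n \<in> K" for n
    proof (rule greatest)
      fix m assume m: "m \<in> K"
      have "q' (x + y) \<le> q (x + y + (m + n)) - g (m + n)" by (rule upper[OF K(2)[OF m n]])
      also have "\<dots> \<le> q (x + m) + q (y + n) - (g m + g n)"
        using sublinear_add[OF q, of "x + m" "y + n"] g(2)[OF m n] by (simp add: algebra_simps)
      finally show "q' (x + y) - (q (y + n) - g n) \<le> q (x + m) - g m" by simp
    qed
    then have "q' (x + y) - q' x \<le> q' y" by (intro greatest) (simp add: algebra_simps)
    then show "q' (x + y) \<le> q' x + q' y" by simp
  next
    show "q' 0 = 0"
      using upper[OF K(1), of 0] greatest[of 0 0] le g(1) sublinear_0[OF q] by force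
  next
    fix r :: real and x assume r: "r > 0"
    have "q' (r *\<^sub>R x) / r \<le> q' x"
    proof (rule greatest)
      fix m assume m: "m \<in> K"
      have "q' (r *\<^sub>R x) \<le> q (r *\<^sub>R x + r *\<^sub>R m) - g (r *\<^sub>R m)" by (rule upper[OF K(3)[OF r m]])
      also have "\<dots> = r * (q (x + m) - g m)"
        using sublinear_scaleR[OF q, of r "x + m"] g(3)[OF r m] r
        by (simp add: scaleR_add_right algebra_simps)
      finally show "q' (r *\<^sub>R x) / r \<le> q (x + m) - g m" using r by (simp add: field_simps)
    qed
    then show "q' (r *\<^sub>R x) \<le> r * q' x" using r by (simp add: field_simps)
  qed
  moreover have "q' x \<le> q x" for x using upper[OF K(1), of x] g(1) by simp
  moreover have "q' (- m) \<le> - g m" if "m \<in> K" for m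
    using upper[OF that, of "- m"] sublinear_0[OF q] by simp
  ultimately show thesis by (rule that)
qed

text \<open>Zorn's lemma for the reversed pointwise order. The infimum of a chain is finite, since every
sublinear \<open>q \<le> p\<close> satisfies \<open>- p (- x) \<le> q x\<close>.\<close>

lemma exists_minimal_sublinear:
  assumes p: "sublinear p"
  obtains q where "sublinear q" "q \<le> p" "\<And>q'. sublinear q' \<Longrightarrow> q' \<le> q \<Longrightarrow> q' = q"
proof -
  let ?A = "{q. sublinear q \<and> q \<le> p}"
  have "\<exists>m\<in>?A. \<forall>a\<in>?A. a \<le> m \<longrightarrow> a = m"
  proof (rule predicate_Zorn)
    show "partial_order_on ?A (relation_of (\<lambda>q q'. q' \<le> q) ?A)"
      by (rule partial_order_on_relation_ofI) auto
    fix C assume "C \<in> Chains (relation_of (\<lambda>q q'. q' \<le> q) ?A)"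
    then have C: "\<And>q. q \<in> C \<Longrightarrow> sublinear q" "\<And>q. q \<in> C \<Longrightarrow> q \<le> p"
      and chain: "\<And>q q'. q \<in> C \<Longrightarrow> q' \<in> C \<Longrightarrow> q \<le> q' \<or> q' \<le> q"
      unfolding Chains_def relation_of_def by auto
    show "\<exists>u\<in>?A. \<forall>q\<in>C. u \<le> q"
    proof (cases "C = {}")
      case True then show ?thesis using p by auto
    next
      case False
      define u where "u x = (INF q\<in>C. q x)" for x
      have lower: "- p (- x) \<le> q x" if "q \<in> C" for q x
        using sublinear_uminus_le[OF C(1)[OF that], of x] le_funD[OF C(2)[OF that], of "- x"] by simp
      have upper: "u x \<le> q x" if "q \<in> C" for q x
        unfolding u_def using lower that by (intro cINF_lower bdd_belowI[of _ "- p (- x)"]) auto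
      have greatest: "c \<le> u x" if "\<And>q. q \<in> C \<Longrightarrow> c \<le> q x" for c x
        unfolding u_def using False that by (intro cINF_greatest) auto
      have "sublinear u"
      proof (rule sublinearI)
        fix x y
        have "u (x + y) - q' y \<le> u x" if q': "q' \<in> C" for q'
        proof (rule greatest)
          fix q assume q: "q \<in> C"
          \<comment> \<open>The smaller of two members of the chain witnesses subadditivity for both.\<close>
          obtain s where "s \<in> C" "s \<le> q" "s \<le> q'" using chain[OF q q'] q q' by blast
          then show "u (x + y) - q' y \<le> q x"
            using upper[of s "x + y"] sublinear_add[OF C(1), of s x y]
              le_funD[of s q x] le_funD[of s q' y] by linarith
        qed
        then have "u (x + y) - u x \<le> u y" by (intro greatest) (simp add: algebra_simps)
        then show "u (x + y) \<le> u x + u y" by simp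
      next
        have "u 0 \<le> 0" using False upper[of _ 0] sublinear_0[OF C(1)] by fastforce
        moreover have "0 \<le> u 0" by (rule greatest) (simp add: sublinear_0[OF C(1)])
        ultimately show "u 0 = 0" by simp
      next
        fix r :: real and x :: 'a assume r: "r > 0"
        have "u (r *\<^sub>R x) / r \<le> u x"
        proof (rule greatest)
          fix q assume q: "q \<in> C"
          show "u (r *\<^sub>R x) / r \<le> q x"
            using upper[OF q, of "r *\<^sub>R x"] sublinear_scaleR[OF C(1)[OF q], of r x] r
            by (simp add: field_simps)
        qed
        then show "u (r *\<^sub>R x) \<le> r * u x" using r by (simp add: field_simps)
      qed
      moreover have "u \<le> p"
        using False upper C(2) by (metis ex_in_conv le_funI order_trans le_fun_def)
      ultimately show ?thesis using upper by (auto simp: le_fun_def)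
    qed
  qed
  then show thesis using that by (auto intro: order_trans)
qed

text \<open>On the ray \<open>K\<close> through \<open>y\<close> the functional \<open>q\<close> is itself additive, so it may be used as the
functional \<open>g\<close> on the cone. By minimality the modification equals \<open>q\<close>, and its last property
becomes \<open>q (- y) \<le> - q y\<close>.\<close>

lemma minimal_sublinear_additive:
  assumes q: "sublinear q" and min: "\<And>q'. sublinear q' \<Longrightarrow> q' \<le> q \<Longrightarrow> q' = q"
  shows "q (x + y) = q x + q y"
proof (rule antisym[OF sublinear_add[OF q]])
  let ?K = "{t *\<^sub>R y | t. t \<ge> 0}"
  obtain q' where q': "sublinear q'" "\<And>x. q' x \<le> q x" "\<And>m. m \<in> ?K \<Longrightarrow> q' (- m) \<le> - q m"
  proof (rule sublinear_below_on_cone[OF q, of ?K q])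
    show "0 \<in> ?K" by (auto intro: exI[of _ 0])
    show "m + n \<in> ?K" if "m \<in> ?K" "n \<in> ?K" for m n
      using that by (auto simp: scaleR_add_left[symmetric] simp del: scaleR_cancel_right)
    show "r *\<^sub>R m \<in> ?K" if "r > 0" "m \<in> ?K" for r m
      using that by (auto simp del: scaleR_cancel_right)
    show "q (m + n) = q m + q n" if mn: "m \<in> ?K" "n \<in> ?K" for m n
    proof -
      from mn obtain s t where "s \<ge> 0" "t \<ge> 0" "m = s *\<^sub>R y" "n = t *\<^sub>R y" by auto
      then show ?thesis
        by (simp add: scaleR_add_left[symmetric] sublinear_scaleR[OF q] distrib_right)
    qed
  qed (simp_all add: sublinear_0 sublinear_scaleR q)
  have "q' = q" using q'(1,2) by (intro min) (auto simp: le_fun_def)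
  moreover have "y \<in> ?K" by (auto intro!: exI[of _ 1])
  ultimately have "q (- y) \<le> - q y" using q'(3) by auto
  then show "q x + q y \<le> q (x + y)" using sublinear_add[OF q, of "x + y" "- y"] by simp
qed

text \<open>First lower \<open>p\<close> until it forces \<open>g\<close> on \<open>M\<close>, then pass to a minimal sublinear functional. On \<open>M\<close>
the resulting linear \<open>G\<close> satisfies \<open>G (- m) \<le> - g m\<close>, and replacing \<open>m\<close> by \<open>- m\<close> turns this into
equality.\<close>

lemma hahn_banach_sublinear:
  fixes p :: "'a::real_vector \<Rightarrow> real"
  assumes p: "sublinear p" and M: "subspace M"
    and add: "\<And>x y. x \<in> M \<Longrightarrow> y \<in> M \<Longrightarrow> g (x + y) = g x + g y"
    and scale: "\<And>r x. x \<in> M \<Longrightarrow> g (r *\<^sub>R x) = r * g x"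
    and le: "\<And>x. x \<in> M \<Longrightarrow> g x \<le> p x"
  obtains G where "linear G" "\<And>x. G x \<le> p x" "\<And>x. x \<in> M \<Longrightarrow> G x = g x"
proof -
  have g0: "g 0 = 0" using scale[of 0 0] subspace_0[OF M] by simp
  obtain q where q: "sublinear q" "\<And>x. q x \<le> p x" "\<And>m. m \<in> M \<Longrightarrow> q (- m) \<le> - g m"
    by (rule sublinear_below_on_cone[OF p, of M g])
      (auto simp: M subspace_0 subspace_add subspace_scale g0 add scale le)
  obtain G where G: "sublinear G" "G \<le> q" "\<And>q'. sublinear q' \<Longrightarrow> q' \<le> G \<Longrightarrow> q' = G"
    by (rule exists_minimal_sublinear[OF q(1)]) blast
  have Gadd: "G (x + y) = G x + G y" for x y by (rule minimal_sublinear_additive[OF G(1,3)])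
  have Gminus: "G (- x) = - G x" for x using Gadd[of x "- x"] sublinear_0[OF G(1)] by simp
  have "linear G"
  proof
    fix r :: real and x
    show "G (r *\<^sub>R x) = r *\<^sub>R G x"
    proof (cases "r \<ge> 0")
      case False
      then have "G ((- r) *\<^sub>R x) = (- r) * G x" by (intro sublinear_scaleR[OF G(1)]) simp
      then show ?thesis using Gminus[of "r *\<^sub>R x"] by simp
    qed (simp add: sublinear_scaleR[OF G(1)])
  qed (rule Gadd)
  moreover have "G x \<le> p x" for x using le_funD[OF G(2), of x] q(2)[of x] by simp
  moreover have "G x = g x" if x: "x \<in> M" for x
  proof (rule antisym)
    have "g (- x) = - g x" using scale[OF x, of "- 1"] by simp
    then show "G x \<le> g x" using le_funD[OF G(2), of x] q(3)[OF subspace_neg[OF M x]] by simp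
    show "g x \<le> G x" using le_funD[OF G(2), of "- x"] q(3)[OF x] Gminus[of x] by simp
  qed
  ultimately show thesis by (rule that)
qed

section \<open>Functionals on complex normed spaces\<close>

lemma cblinfun_apply_add: "cblinfun_apply T (x + y) = cblinfun_apply T x + cblinfun_apply T y"
  and cblinfun_apply_diff: "cblinfun_apply T (x - y) = cblinfun_apply T x - cblinfun_apply T y"
  and cblinfun_apply_scaleR: "cblinfun_apply T (r *\<^sub>R x) = r *\<^sub>R cblinfun_apply T x"
  and cblinfun_apply_0 [simp]: "cblinfun_apply T 0 = 0"
  using bounded_linear_cblinfun_apply[of T]
  by (simp_all add: bounded_linear.linear linear_add linear_diff linear_cmul linear_0)

lemma cblinfun_apply_scaleC: "cblinfun_apply T (c *\<^sub>C x) = c *\<^sub>C cblinfun_apply T x"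
  using bounded_clinear_cblinfun_apply[of T] by (simp add: bounded_clinear_def)

lemma bounded_clinear_intro:
  assumes "\<And>x y. f (x + y) = f x + f y" "\<And>c x. f (c *\<^sub>C x) = c *\<^sub>C f x"
    and "\<And>x. norm (f x) \<le> K * norm x"
  shows "bounded_clinear f"
  unfolding bounded_clinear_def using assms
  by (auto intro!: bounded_linear_intro[where K = K] simp: scaleR_scaleC mult.commute)

lemma cblinfun_eqI: "(\<And>x. cblinfun_apply S x = cblinfun_apply T x) \<Longrightarrow> S = T"
  by (simp add: cblinfun_apply_inject[symmetric] fun_eq_iff)

lemma norm_cblinfun_bound:
  assumes "\<And>x. norm (cblinfun_apply T x) \<le> C * norm x" "C \<ge> 0"
  shows "norm T \<le> C"
  using assms by (auto simp: norm_cblinfun.rep_eq intro: onorm_bound)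

lemma complex_functional_from_real_part:
  fixes U :: "'a::complex_normed_vector \<Rightarrow> real"
  assumes U: "linear U" and le: "\<And>x. U x \<le> C * norm x"
  obtains F :: "('a, complex) cblinfun"
  where "\<And>x. cblinfun_apply F x = Complex (U x) (- U (\<i> *\<^sub>C x))"
    "\<And>x. norm (cblinfun_apply F x) \<le> C * norm x"
proof -
  let ?F = "\<lambda>x. Complex (U x) (- U (\<i> *\<^sub>C x))"
  have add: "?F (x + y) = ?F x + ?F y" for x y
    by (simp add: complex_eq_iff scaleC_add_right linear_add[OF U])
  have scale: "?F (c *\<^sub>C x) = c *\<^sub>C ?F x" for c x
  proof -
    have U': "U (z *\<^sub>C x) = Re z * U x + Im z * U (\<i> *\<^sub>C x)" for z
    proof -
      have "z *\<^sub>C x = Re z *\<^sub>R x + Im z *\<^sub>R (\<i> *\<^sub>C x)"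
        by (simp add: scaleR_scaleC scaleC_scaleC scaleC_add_left[symmetric])
          (metis complex_eq mult.commute)
      then show ?thesis by (simp add: linear_add[OF U] linear_cmul[OF U])
    qed
    show ?thesis
      using U'[of c] U'[of "\<i> * c"] by (simp add: scaleC_scaleC scaleC_complex_def complex_eq_iff)
  qed
  have bound: "norm (?F x) \<le> C * norm x" for x
  proof (cases "?F x = 0")
    case True
    have "0 \<le> C * norm x" using le[of x] le[of "- x"] linear_neg[OF U, of x] by simp
    then show ?thesis using True by simp
  next
    case False
    \<comment> \<open>A rotation makes the value of the functional real, where its real part controls it.\<close>
    define c where "c = cnj (?F x) / cmod (?F x)"
    have c: "cmod c = 1" using False by (simp add: c_def norm_divide)
    have "?F (c *\<^sub>C x) = c * ?F x" by (simp only: scale scaleC_complex_def)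
    also have "\<dots> = of_real (cmod (?F x))"
      using False by (simp add: c_def complex_norm_square[symmetric] power2_eq_square
          mult.commute[of "cnj _"] divide_simps)
    finally have "U (c *\<^sub>C x) = cmod (?F x)" by (metis Re_complex_of_real complex.sel(1))
    then show ?thesis using le[of "c *\<^sub>C x"] c by (simp add: norm_scaleC)
  qed
  have "bounded_clinear ?F" using add scale bound by (rule bounded_clinear_intro)
  then have "cblinfun_apply (Cblinfun ?F) = ?F" by (simp add: Cblinfun_inverse)
  with bound show thesis using that[of "Cblinfun ?F"] by simp
qed

text \<open>A complex-linear functional is determined by its real part, so the norm-preserving extension is
obtained from the real theorem with \<open>p x = C * norm x\<close>.\<close>

theorem hahn_banach_complex:
  fixes g :: "'a::complex_normed_vector \<Rightarrow> complex"
  assumes M: "complex_vector.subspace M"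
    and add: "\<And>x y. x \<in> M \<Longrightarrow> y \<in> M \<Longrightarrow> g (x + y) = g x + g y"
    and scale: "\<And>c x. x \<in> M \<Longrightarrow> g (c *\<^sub>C x) = c * g x"
    and le: "\<And>x. x \<in> M \<Longrightarrow> cmod (g x) \<le> C * norm x" and C: "C \<ge> 0"
  obtains F :: "('a, complex) cblinfun"
  where "norm F \<le> C" "\<And>x. x \<in> M \<Longrightarrow> cblinfun_apply F x = g x"
proof -
  have p: "sublinear (\<lambda>x :: 'a. C * norm x)"
    using C by (auto simp: sublinear_def distrib_left[symmetric] norm_triangle_ineq mult_left_mono)
  have "subspace M"
    using M by (auto simp: subspace_def complex_vector.subspace_def scaleR_scaleC)
  then obtain U where U: "linear U" "\<And>x. U x \<le> C * norm x" "\<And>x. x \<in> M \<Longrightarrow> U x = Re (g x)"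
  proof (rule hahn_banach_sublinear[OF p, of M "\<lambda>x. Re (g x)"])
    show "Re (g x) \<le> C * norm x" if "x \<in> M" for x
      using le[OF that] complex_Re_le_cmod[of "g x"] by linarith
  qed (auto simp: add scale scaleR_scaleC)
  obtain F :: "('a, complex) cblinfun"
    where F: "\<And>x. cblinfun_apply F x = Complex (U x) (- U (\<i> *\<^sub>C x))"
      "\<And>x. norm (cblinfun_apply F x) \<le> C * norm x"
    by (rule complex_functional_from_real_part[OF U(1,2)]) blast
  have "cblinfun_apply F x = g x" if x: "x \<in> M" for x
  proof -
    have "U (\<i> *\<^sub>C x) = - Im (g x)"
      using U(3)[OF complex_vector.subspace_scale[OF M x, of \<i>]] scale[OF x, of \<i>] by simp
    then show ?thesis by (simp add: F(1) U(3)[OF x] complex_eq_iff)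
  qed
  with norm_cblinfun_bound[OF F(2) C] show thesis by (rule that)
qed

corollary exists_norming_functional:
  fixes x :: "'a::complex_normed_vector"
  obtains F :: "('a, complex) cblinfun"
  where "norm F \<le> 1" "cblinfun_apply F x = of_real (norm x)"
proof (cases "x = 0")
  case True
  then show thesis using that[of 0] by simp
next
  case False
  let ?M = "range (\<lambda>c. c *\<^sub>C x)"
  define coord where "coord y = (SOME c. y = c *\<^sub>C x)" for y
  have coord: "coord (c *\<^sub>C x) = c" for c
  proof -
    have "c *\<^sub>C x = coord (c *\<^sub>C x) *\<^sub>C x" unfolding coord_def by (rule someI_ex) blast
    with False show ?thesis by (simp add: complex_vector.scale_cancel_right)
  qed
  have "complex_vector.subspace ?M"
    using complex_vector.subspace_span[of "{x}"] by (simp only: complex_vector.span_singleton)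
  then obtain F :: "('a, complex) cblinfun"
    where F: "norm F \<le> 1" "\<And>y. y \<in> ?M \<Longrightarrow> cblinfun_apply F y = coord y * of_real (norm x)"
  proof (rule hahn_banach_complex[where C = 1 and g = "\<lambda>y. coord y * of_real (norm x)"])
    fix y z assume "y \<in> ?M" "z \<in> ?M"
    then obtain c d where "y = c *\<^sub>C x" "z = d *\<^sub>C x" by blast
    then show "coord (y + z) * of_real (norm x) = coord y * of_real (norm x) + coord z * of_real (norm x)"
      using coord[of "c + d"] by (simp add: coord scaleC_add_left distrib_right)
  next
    fix a y assume "y \<in> ?M"
    then obtain c where "y = c *\<^sub>C x" by blast
    then show "coord (a *\<^sub>C y) * of_real (norm x) = a * (coord y * of_real (norm x))"
      using coord[of "a * c"] by (simp add: coord scaleC_scaleC)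
  next
    fix y assume "y \<in> ?M"
    then obtain c where "y = c *\<^sub>C x" by blast
    then show "cmod (coord y * of_real (norm x)) \<le> 1 * norm y"
      by (simp add: coord norm_mult norm_scaleC)
  qed (blast | simp)+
  have "x \<in> ?M" by (rule range_eqI[where x = 1]) (simp add: scaleC_one)
  then have "cblinfun_apply F x = of_real (norm x)"
    using F(2)[of x] coord[of 1] by (simp only: scaleC_one) simp
  with F(1) show thesis by (rule that)
qed

text \<open>Induction on \<open>S\<close>: if \<open>e\<close> does not vanish on the common kernel of the others, then subtracting a
multiple of \<open>e\<close> from \<open>\<psi>\<close> makes it vanish there.\<close>

lemma functional_in_span_of_kernel_inclusion:
  fixes \<psi> :: "('a::complex_normed_vector, complex) cblinfun"
  assumes "finite S"
    and "\<And>f. (\<And>e. e \<in> S \<Longrightarrow> cblinfun_apply e f = 0) \<Longrightarrow> cblinfun_apply \<psi> f = 0"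
  shows "\<psi> \<in> cspan S"
  using assms
proof (induction S arbitrary: \<psi> rule: finite_induct)
  case empty
  then have "\<psi> = 0" by (intro cblinfun_eqI) (simp add: zero_cblinfun.rep_eq)
  then show ?case by (simp add: complex_vector.span_zero)
next
  case (insert e S)
  show ?case
  proof (cases "\<exists>f. (\<forall>e'\<in>S. cblinfun_apply e' f = 0) \<and> cblinfun_apply e f \<noteq> 0")
    case False
    then have "\<psi> \<in> cspan S" using insert.prems by (intro insert.IH) auto
    then show ?thesis using complex_vector.span_mono[of S "insert e S"] by blast
  next
    case True
    then obtain f0 where f0: "\<And>e'. e' \<in> S \<Longrightarrow> cblinfun_apply e' f0 = 0" "cblinfun_apply e f0 \<noteq> 0"
      by blast
    define c where "c = cblinfun_apply \<psi> f0 / cblinfun_apply e f0"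
    have "\<psi> - c *\<^sub>C e \<in> cspan S"
    proof (rule insert.IH)
      fix f assume f: "\<And>e'. e' \<in> S \<Longrightarrow> cblinfun_apply e' f = 0"
      \<comment> \<open>Moving along \<open>f0\<close> puts \<open>f\<close> into the kernel of \<open>e\<close> as well.\<close>
      define g where "g = f - (cblinfun_apply e f / cblinfun_apply e f0) *\<^sub>C f0"
      have "cblinfun_apply \<psi> g = 0"
        using f f0 by (intro insert.prems)
          (auto simp: g_def cblinfun_apply_diff cblinfun_apply_scaleC scaleC_complex_def)
      then show "cblinfun_apply (\<psi> - c *\<^sub>C e) f = 0"
        by (simp add: g_def c_def minus_cblinfun.rep_eq scaleC_cblinfun.rep_eq cblinfun_apply_diff
            cblinfun_apply_scaleC scaleC_complex_def mult.commute)
    qed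
    then have "\<psi> - c *\<^sub>C e \<in> cspan (insert e S)"
      using complex_vector.span_mono[of S "insert e S"] by blast
    moreover have "c *\<^sub>C e \<in> cspan (insert e S)"
      by (intro complex_vector.span_scale complex_vector.span_base) simp
    ultimately show ?thesis using complex_vector.span_add by fastforce
  qed
qed

section \<open>Density of the evaluations in the predual\<close>

lemma G0_eqI: "(\<And>f. G0_apply \<phi> f = G0_apply \<psi> f) \<Longrightarrow> \<phi> = \<psi>"
  by (auto simp: G0_apply_def G0_functional_inject[symmetric] intro: cblinfun_eqI)

lemma G0_apply_simps:
  "G0_apply (\<phi> + \<psi>) f = G0_apply \<phi> f + G0_apply \<psi> f"
  "G0_apply (\<phi> - \<psi>) f = G0_apply \<phi> f - G0_apply \<psi> f"
  "G0_apply (c *\<^sub>C \<phi>) f = c * G0_apply \<phi> f"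
  "G0_apply 0 f = 0"
  "G0_apply \<phi> (f + g) = G0_apply \<phi> f + G0_apply \<phi> g"
  "G0_apply \<phi> (f - g) = G0_apply \<phi> f - G0_apply \<phi> g"
  "G0_apply \<phi> (c *\<^sub>C f) = c * G0_apply \<phi> f"
  by (simp_all add: G0_apply_def plus_G0.rep_eq minus_G0.rep_eq scaleC_G0.rep_eq zero_G0.rep_eq
      plus_cblinfun.rep_eq minus_cblinfun.rep_eq scaleC_cblinfun.rep_eq zero_cblinfun.rep_eq
      cblinfun_apply_add cblinfun_apply_diff cblinfun_apply_scaleC scaleC_complex_def)

lemma norm_G0_apply: "cmod (G0_apply \<phi> f) \<le> norm \<phi> * norm f"
  by (simp add: G0_apply_def norm_G0.rep_eq norm_cblinfun)

lemma norm_functional_bound: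
  fixes \<phi> :: "('a::complex_normed_vector, complex) cblinfun"
  assumes "\<And>f. norm f \<le> 1 \<Longrightarrow> cmod (cblinfun_apply \<phi> f) \<le> C"
  shows "norm \<phi> \<le> C"
proof (rule norm_cblinfun_bound)
  show "C \<ge> 0" using assms[of 0] by simp
  show "cmod (cblinfun_apply \<phi> f) \<le> C * norm f" for f
  proof (cases "f = 0")
    case False
    have "cmod (cblinfun_apply \<phi> (inverse (norm f) *\<^sub>R f)) \<le> C"
      using False by (intro assms) simp
    then show ?thesis using False by (simp add: cblinfun_apply_scaleR field_simps)
  qed simp
qed

lemma norm_G0_bound:
  "(\<And>f. norm f \<le> 1 \<Longrightarrow> cmod (G0_apply \<phi> f) \<le> C) \<Longrightarrow> norm \<phi> \<le> C"
  unfolding norm_G0.rep_eq G0_apply_def by (rule norm_functional_bound)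

lemma HL0_apply_outside: "x \<notin> ball 0 1 \<Longrightarrow> HL0_apply f x = 0"
  by transfer (auto simp: HL0_set_def)

lemma HL0_apply_0 [simp]: "HL0_apply f 0 = 0"
  by transfer (simp add: HL0_set_def)

lemma HL0_norm_bound:
  assumes "\<And>x y. x \<in> ball 0 1 \<Longrightarrow> y \<in> ball 0 1 \<Longrightarrow>
      norm (HL0_apply f x - HL0_apply f y) \<le> C * norm (x - y)" and "C \<ge> 0"
  shows "norm f \<le> C"
  unfolding norm_HL0.rep_eq by (rule Lip_le, rule lipschitz_onI) (simp_all only: dist_norm assms)

lemma HL0_apply_norm_diff:
  assumes "x \<in> ball 0 1" "y \<in> ball 0 1"
  shows "norm (HL0_apply f x - HL0_apply f y) \<le> norm f * norm (x - y)"
  using lipschitz_onD[OF HL0_apply_lipschitz assms] by (simp add: dist_norm)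

text \<open>Maps in the unit ball are equi-Lipschitz, so vanishing on a sufficiently fine finite net of the
compact set from the continuity of \<open>\<phi>\<close> at \<open>0\<close> makes them small on the whole compact set.\<close>

lemma tau0_continuous_small_on_finite_annihilator:
  fixes \<phi> :: "(('x::cbanach, complex) HL0, complex) cblinfun"
  assumes \<phi>: "tau0_continuous \<phi>" and e: "e > 0"
  obtains S where "finite S" "S \<subseteq> ball 0 1"
    "\<And>f. (\<And>x. x \<in> S \<Longrightarrow> HL0_apply f x = 0) \<Longrightarrow> cmod (cblinfun_apply \<phi> f) \<le> e * norm f"
proof -
  obtain K d where K: "compact K" "K \<subseteq> ball 0 1" "d > 0"
    and small: "\<And>g. norm g \<le> 1 \<Longrightarrow> (\<forall>x\<in>K. norm (HL0_apply g x) < d) \<Longrightarrow>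
         cmod (cblinfun_apply \<phi> g) < e"
    using \<phi>[unfolded tau0_continuous_iff, rule_format, of 0 e] e
    by (auto simp: zero_HL0.rep_eq)
  obtain S where S: "finite S" "S \<subseteq> K" "K \<subseteq> (\<Union>x\<in>S. ball x d)"
    using seq_compact_imp_totally_bounded[of K] K(1,3) by (auto simp: compact_eq_seq_compact_metric)
  have "cmod (cblinfun_apply \<phi> f) \<le> e * norm f" if f: "\<And>x. x \<in> S \<Longrightarrow> HL0_apply f x = 0" for f
  proof (cases "f = 0")
    case False
    define g where "g = complex_of_real (inverse (norm f)) *\<^sub>C f"
    have g: "norm g \<le> 1" using False by (simp add: g_def norm_scaleC norm_inverse)
    have "norm (HL0_apply g y) < d" if y: "y \<in> K" for y
    proof -
      obtain x where x: "x \<in> S" "dist x y < d" using S(3) y by auto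
      have "norm (HL0_apply g y - HL0_apply g x) \<le> norm g * norm (y - x)"
        using x(1) y S(2) K(2) by (intro HL0_apply_norm_diff) auto
      also have "\<dots> \<le> 1 * norm (y - x)" using g by (intro mult_right_mono) auto
      also have "\<dots> < d" using x(2) by (simp add: dist_norm norm_minus_commute)
      finally show ?thesis using f[OF x(1)] by (simp add: g_def scaleC_HL0.rep_eq)
    qed
    then have "cmod (cblinfun_apply \<phi> g) < e" using g by (intro small) auto
    then show ?thesis using False
      by (simp add: g_def cblinfun_apply_scaleC scaleC_complex_def norm_mult norm_inverse norm_divide field_simps)
  qed simp
  moreover have "S \<subseteq> ball 0 1" using S(2) K(2) by blast
  ultimately show thesis using S(1) that by blast
qed

text \<open>Transports linear combinations from the full dual of the holomorphic Lipschitz functions, where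
Hahn-Banach takes place, back into the predual.\<close>

lemma cspan_evaluation_lifts_to_cspan_delta:
  assumes "\<psi> \<in> cspan (evaluation ` S)"
  shows "\<exists>\<xi>\<in>cspan (delta ` S). G0_functional \<xi> = \<psi>"
  using assms
proof (induction rule: complex_vector.span_induct_alt)
  case base
  show ?case by (rule bexI[of _ 0]) (simp_all add: zero_G0.rep_eq complex_vector.span_zero)
next
  case (step c e \<psi>)
  then obtain x \<xi> where x: "x \<in> S" "e = evaluation x"
    and \<xi>: "\<xi> \<in> cspan (delta ` S)" "G0_functional \<xi> = \<psi>" by auto
  have "c *\<^sub>C delta x + \<xi> \<in> cspan (delta ` S)"
    using x(1) \<xi>(1) by (intro complex_vector.span_add complex_vector.span_scale)
      (auto intro: complex_vector.span_base)
  then show ?case using x(2) \<xi>(2)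
    by (intro bexI[of _ "c *\<^sub>C delta x + \<xi>"]) (simp add: plus_G0.rep_eq scaleC_G0.rep_eq delta.rep_eq)
qed

text \<open>Let \<open>N\<close> be the space of functions that vanish on the finite set \<open>S\<close> of the preceding estimate.
There \<open>\<phi>\<close> has norm at most \<open>e/2\<close>; extend this restriction to \<open>\<psi>\<close> with the same bound. Then
\<open>\<phi> - \<psi>\<close> vanishes on \<open>N\<close> and hence is a combination of the evaluations at the points of \<open>S\<close>.
The distance of \<open>\<phi>\<close> to this combination is the norm of \<open>\<psi>\<close>.\<close>

theorem delta_span_dense:
  "closure (cspan (delta ` ball 0 1)) = (UNIV :: 'x::cbanach G0 set)"
proof -
  have "\<exists>\<xi>\<in>cspan (delta ` ball 0 1). dist \<xi> \<phi> < e" if e: "e > 0" for \<phi> :: "'x G0" and e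
  proof -
    obtain S :: "'x set" where S: "finite S" "S \<subseteq> ball 0 1"
      and small: "\<And>f. (\<And>x. x \<in> S \<Longrightarrow> HL0_apply f x = 0) \<Longrightarrow>
        cmod (cblinfun_apply (G0_functional \<phi>) f) \<le> (e/2) * norm f"
    proof (rule tau0_continuous_small_on_finite_annihilator[of "G0_functional \<phi>" "e/2"])
      show "tau0_continuous (G0_functional \<phi>)" using G0_functional by blast
      show "e / 2 > 0" using e by simp
    qed blast
    let ?N = "{f :: ('x, complex) HL0. \<forall>x\<in>S. HL0_apply f x = 0}"
    have "complex_vector.subspace ?N"
      by (auto simp: complex_vector.subspace_def zero_HL0.rep_eq plus_HL0.rep_eq scaleC_HL0.rep_eq
          scaleC_zero_right)
    then obtain \<psi> where \<psi>: "norm \<psi> \<le> e/2"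
      "\<And>f. f \<in> ?N \<Longrightarrow> cblinfun_apply \<psi> f = cblinfun_apply (G0_functional \<phi>) f"
    proof (rule hahn_banach_complex[where C = "e/2" and g = "cblinfun_apply (G0_functional \<phi>)"])
      show "cmod (cblinfun_apply (G0_functional \<phi>) f) \<le> e/2 * norm f" if "f \<in> ?N" for f
        using that by (intro small) auto
      show "0 \<le> e/2" using e by simp
    qed (rule cblinfun_apply_add, simp only: cblinfun_apply_scaleC scaleC_complex_def, blast)
    have "G0_functional \<phi> - \<psi> \<in> cspan (evaluation ` S)"
    proof (rule functional_in_span_of_kernel_inclusion)
      fix f :: "('x, complex) HL0"
      assume "\<And>\<eta>. \<eta> \<in> evaluation ` S \<Longrightarrow> cblinfun_apply \<eta> f = 0"
      then have "cblinfun_apply (evaluation x) f = 0" if "x \<in> S" for x using that by blast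
      then have "f \<in> ?N" by (simp add: evaluation.rep_eq)
      then show "cblinfun_apply (G0_functional \<phi> - \<psi>) f = 0" using \<psi>(2) by (simp add: minus_cblinfun.rep_eq)
    qed (use S(1) in simp)
    then obtain \<xi> where \<xi>: "\<xi> \<in> cspan (delta ` S)" "G0_functional \<xi> = G0_functional \<phi> - \<psi>"
      using cspan_evaluation_lifts_to_cspan_delta by blast
    have "dist \<xi> \<phi> = norm \<psi>"
      by (simp add: dist_norm norm_G0.rep_eq minus_G0.rep_eq \<xi>(2))
    moreover have "\<xi> \<in> cspan (delta ` ball 0 1)"
      using \<xi>(1) complex_vector.span_mono[OF image_mono[OF S(2)]] by blast
    ultimately show ?thesis using \<psi>(1) e by (intro bexI[of _ \<xi>]) auto
  qed
  then show ?thesis by (auto simp: closure_approachable)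
qed

section \<open>Holomorphy of the evaluation map\<close>

text \<open>Divide by the variable: \<open>g z = z * q z\<close> with \<open>\<bar>q\<bar> \<le> C\<close> on the disc. The Schwarz lemma for
\<open>(q - q 0) / 3C\<close> then bounds the second-order remainder. The constant \<open>3\<close> instead of \<open>2\<close> provides
the strict inequality which the Schwarz lemma asks for.\<close>

lemma schwarz_linearization:
  fixes g :: "complex \<Rightarrow> complex"
  assumes hol: "g holomorphic_on ball 0 1" and zero: "g 0 = 0"
    and le: "\<And>z. cmod z < 1 \<Longrightarrow> cmod (g z) \<le> C * cmod z" and C: "C > 0" and z: "cmod z < 1"
  shows "cmod (deriv g 0) \<le> C" "cmod (g z - z * deriv g 0) \<le> 3 * C * (cmod z)\<^sup>2"
proof -
  obtain q where q: "q holomorphic_on ball 0 1" "\<And>z. cmod z < 1 \<Longrightarrow> g z = z * q z"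
    and q0: "deriv g 0 = q 0"
    using Schwarz3[OF hol zero] by blast
  have q_le: "cmod (q w) \<le> C" if w: "cmod w < 1" "w \<noteq> 0" for w
    using le[OF w(1)] q(2)[OF w(1)] w(2) by (simp add: norm_mult mult.commute)
  have "(q \<longlongrightarrow> q 0) (at 0)"
    using holomorphic_on_imp_continuous_on[OF q(1)]
    by (simp add: continuous_on_eq_continuous_at isCont_def)
  moreover have "\<forall>\<^sub>F w in at 0. cmod (q w) \<le> C"
    unfolding eventually_at by (rule exI[of _ 1]) (use q_le in auto)
  ultimately have q0_le: "cmod (q 0) \<le> C"
    by (rule Lim_norm_ubound[rotated]) simp
  then show "cmod (deriv g 0) \<le> C" by (simp add: q0)
  let ?s = "\<lambda>w. (q w - q 0) / of_real (3 * C)"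
  have "cmod (?s z) \<le> cmod z"
  proof (rule Schwarz_Lemma(1))
    show "?s holomorphic_on ball 0 1" using q(1) C by (intro holomorphic_intros) auto
    show "cmod (?s w) < 1" if w: "cmod w < 1" for w
    proof -
      have "cmod (q w) \<le> C" using q_le[OF w] q0_le by (cases "w = 0") auto
      then have "cmod (q w - q 0) < 3 * C" using norm_triangle_ineq4[of "q w" "q 0"] q0_le C by linarith
      then show ?thesis using C by (simp add: norm_divide norm_mult)
    qed
  qed (use z in auto)
  then have "cmod (q z - q 0) \<le> 3 * C * cmod z"
    using C by (simp add: norm_divide norm_mult field_simps)
  then have "cmod z * cmod (q z - q 0) \<le> cmod z * (3 * C * cmod z)"
    by (rule mult_left_mono) simp
  moreover have "g z - z * deriv g 0 = z * (q z - q 0)"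
    by (simp add: q0 q(2)[OF z] right_diff_distrib)
  ultimately show "cmod (g z - z * deriv g 0) \<le> 3 * C * (cmod z)\<^sup>2"
    by (simp add: norm_mult power2_eq_square mult_ac)
qed

lemma HL0_derivative:
  assumes x: "x \<in> ball 0 1"
  obtains D where "bounded_clinear D" "(HL0_apply f has_derivative D) (at x)"
  using x HL0_apply[of f] unfolding HL0_set_def holomorphic_map_on_def by blast

text \<open>The constants depend only on \<open>x\<close>. This uniformity over the unit ball is what turns
differentiability of each single \<open>f\<close> into norm differentiability of the evaluation map.\<close>

lemma HL0_second_order_estimate:
  fixes f :: "('x::cbanach, complex) HL0"
  assumes x: "norm x < 1" and D: "(HL0_apply f has_derivative D) (at x)"
    and f: "norm f \<le> 1" and h: "norm h < 1 - norm x"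
  shows "cmod (D h) \<le> norm h"
    "cmod (HL0_apply f (x + h) - HL0_apply f x - D h) \<le> 3 * (norm h)\<^sup>2 / (1 - norm x)"
proof -
  let ?f = "HL0_apply f"
  have D_clinear: "bounded_clinear D"
    using HL0_derivative[of x f] x D has_derivative_unique by (metis mem_ball_0)
  have D0: "D 0 = 0" using has_derivative_linear[OF D] by (simp add: linear_0)
  define r where "r = 1 - norm x"
  have r: "r > 0" using x by (simp add: r_def)
  have "cmod (D h) \<le> norm h \<and> cmod (?f (x + h) - ?f x - D h) \<le> 3 * (norm h)\<^sup>2 / r"
  proof (cases "h = 0")
    case True then show ?thesis by (simp add: D0)
  next
    case False
    \<comment> \<open>The complex line through \<open>x\<close> in direction \<open>h\<close> meets the ball at least in a disc of radius \<open>r\<close>.\<close>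
    define k where "k = (r / norm h) *\<^sub>R h"
    have k: "norm k = r" using False r by (simp add: k_def)
    have ball: "x + z *\<^sub>C k \<in> ball 0 1" if "cmod z < 1" for z
    proof -
      have "norm (x + z *\<^sub>C k) \<le> norm x + cmod z * r"
        using norm_triangle_ineq[of x "z *\<^sub>C k"] by (simp add: norm_scaleC k)
      also have "\<dots> < norm x + 1 * r" using that r by (intro add_strict_left_mono mult_strict_right_mono)
      finally show ?thesis by (simp add: r_def)
    qed
    define g where "g z = ?f (x + z *\<^sub>C k) - ?f x" for z
    have line: "((\<lambda>z. x + z *\<^sub>C k) has_derivative (\<lambda>t. t *\<^sub>C k)) (at z)" for z
    proof -
      have "bounded_linear (\<lambda>t. t *\<^sub>C k)"
      proof (rule bounded_linear_intro[where K = "norm k"])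
        show "(r *\<^sub>R t) *\<^sub>C k = r *\<^sub>R t *\<^sub>C k" for r t
          by (simp only: scaleR_conv_of_real scaleR_scaleC[of _ "t *\<^sub>C k"] scaleC_scaleC)
      qed (simp_all only: scaleC_add_left norm_scaleC)
      from has_derivative_add[OF has_derivative_const[of x]
          bounded_linear.has_derivative[OF this has_derivative_ident[of "at z"]]]
      show ?thesis by simp
    qed
    have deriv: "(g has_field_derivative E k) (at z)"
      if E: "bounded_clinear E" "(?f has_derivative E) (at (x + z *\<^sub>C k))" for z E
    proof -
      have "(g has_derivative (\<lambda>t. E (t *\<^sub>C k))) (at z)"
        unfolding g_def
        using has_derivative_diff[OF has_derivative_compose[OF line E(2)] has_derivative_const[of "?f x"]]
        by simp
      moreover have "(\<lambda>t. E (t *\<^sub>C k)) = (*) (E k)"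
        using E(1) by (intro ext) (simp add: bounded_clinear_def scaleC_complex_def mult.commute)
      ultimately show ?thesis by (simp only: has_field_derivative_def)
    qed
    have hol: "g holomorphic_on ball 0 1"
    proof (rule holomorphic_onI)
      fix z :: complex assume "z \<in> ball 0 1"
      then have "x + z *\<^sub>C k \<in> ball 0 1" by (intro ball) simp
      then obtain E where "bounded_clinear E" "(?f has_derivative E) (at (x + z *\<^sub>C k))"
        by (rule HL0_derivative)
      then have "(g has_field_derivative E k) (at z)" by (rule deriv)
      then show "g field_differentiable at z within ball 0 1"
        by (meson field_differentiable_at_within field_differentiable_def)
    qed
    have g0: "g 0 = 0" by (simp add: g_def)
    have g_le: "cmod (g z) \<le> r * cmod z" if "cmod z < 1" for z
    proof -
      have "cmod (g z) \<le> norm f * norm (z *\<^sub>C k)"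
        using HL0_apply_norm_diff[OF ball[OF that], of x f] x by (simp add: g_def)
      also have "\<dots> \<le> 1 * norm (z *\<^sub>C k)" using f by (intro mult_right_mono) auto
      finally show ?thesis by (simp add: norm_scaleC k mult.commute)
    qed
    define z where "z = complex_of_real (norm h / r)"
    have z: "cmod z < 1" "cmod z = norm h / r"
      using h r by (simp_all only: z_def norm_of_real abs_of_nonneg[of "norm h / r"] r_def[symmetric]
          norm_ge_zero divide_nonneg_pos divide_less_eq_1_pos)
    note S = schwarz_linearization[OF hol g0 g_le r z(1)]
    have g': "deriv g 0 = D k"
      using deriv[of D 0] D D_clinear by (simp add: DERIV_imp_deriv)
    have zk: "z *\<^sub>C k = h"
      using False r unfolding z_def scaleR_scaleC[symmetric] k_def by simp
    have Dh: "D h = z * D k"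
      using D_clinear zk by (metis bounded_clinear_def scaleC_complex_def)
    have "cmod (D h) \<le> cmod z * r"
      using mult_left_mono[OF S(1), of "cmod z"] by (simp add: Dh g' norm_mult)
    moreover have "cmod z * r = norm h" "3 * r * (cmod z)\<^sup>2 = 3 * (norm h)\<^sup>2 / r"
      using r z(2) by (simp_all add: power2_eq_square)
    moreover have "g z = ?f (x + h) - ?f x" by (simp add: g_def zk)
    ultimately show ?thesis using S(2) by (simp only: g' Dh)
  qed
  then show "cmod (D h) \<le> norm h"
    "cmod (?f (x + h) - ?f x - D h) \<le> 3 * (norm h)\<^sup>2 / (1 - norm x)" by (simp_all add: r_def)
qed

text \<open>The derivative sends \<open>h\<close> to the functional \<open>f \<mapsto> f' x h\<close>, and the uniform second-order estimate is the
differentiability. That this functional lies in the predual follows from the same estimate: it is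
the norm limit of the difference quotients of evaluations.\<close>

lemma delta_has_derivative:
  fixes x :: "'x::cbanach"
  assumes x: "norm x < 1"
  shows "\<exists>D. bounded_clinear D \<and> (delta has_derivative D) (at x)"
proof -
  define r where "r = 1 - norm x"
  have r: "r > 0" using x by (simp add: r_def)
  define d where "d f = frechet_derivative (HL0_apply f) (at x)" for f :: "('x, complex) HL0"
  have d: "(HL0_apply f has_derivative d f) (at x)" and d_clinear: "bounded_clinear (d f)" for f
  proof -
    obtain D where D: "bounded_clinear D" "(HL0_apply f has_derivative D) (at x)"
      using HL0_derivative[of x f] x by auto
    then have "d f = D" using frechet_derivative_at[OF D(2)] by (simp add: d_def)
    with D show "(HL0_apply f has_derivative d f) (at x)" "bounded_clinear (d f)" by simp_all
  qed
  have d_h: "d f (h + k) = d f h + d f k" "d f (c *\<^sub>C h) = c * d f h" "d f (t *\<^sub>R h) = t *\<^sub>R d f h"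
    for f h k c t
    using d_clinear[of f] bounded_linear.linear[of "d f"]
    by (auto simp: bounded_clinear_def scaleC_complex_def linear_add linear_cmul)
  have d_add: "d (f + g) h = d f h + d g h" for f g h
    using has_derivative_unique[OF d[of "f + g", unfolded plus_HL0.rep_eq]
        has_derivative_add[OF d[of f] d[of g]]] by (simp add: fun_eq_iff)
  have d_scale: "d (c *\<^sub>C f) h = c * d f h" for f c h
    using has_derivative_unique[OF d[of "c *\<^sub>C f", unfolded scaleC_HL0.rep_eq]
        bounded_linear.has_derivative[OF bounded_linear_scaleC d[of f]]]
    by (simp add: fun_eq_iff scaleC_complex_def)
  have estimate: "cmod (HL0_apply f (x + h) - HL0_apply f x - d f h) \<le> 3 * (norm h)\<^sup>2 / r"
    if "norm f \<le> 1" "norm h < r" for f h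
    using HL0_second_order_estimate(2)[OF x d that(1)] that(2) by (simp add: r_def)
  have d_le_1: "cmod (d f h) \<le> norm h" if f: "norm f \<le> 1" for f h
  proof (cases "h = 0")
    case True
    then show ?thesis using d_h(2)[of f 0 h] by (simp add: scaleC_zero_right)
  next
    case False
    define t where "t = r / (2 * norm h)"
    have t: "t > 0" using r False by (simp add: t_def)
    have "norm (t *\<^sub>R h) < r" using r False by (simp add: t_def)
    then have "cmod (d f (t *\<^sub>R h)) \<le> norm (t *\<^sub>R h)"
      unfolding r_def by (rule HL0_second_order_estimate(1)[OF x d f])
    then show ?thesis using t by (simp add: d_h(3))
  qed
  have d_le: "cmod (d f h) \<le> norm h * norm f" for f h
  proof (cases "f = 0")
    case True
    then show ?thesis using d_add[of 0 0 h] by simp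
  next
    case False
    have "cmod (d (complex_of_real (inverse (norm f)) *\<^sub>C f) h) \<le> norm h"
      using False by (intro d_le_1) (simp add: norm_scaleC norm_inverse)
    then have "inverse (norm f) * cmod (d f h) \<le> norm h"
      by (simp only: d_scale norm_mult norm_of_real abs_inverse abs_norm_cancel)
    then show ?thesis using False by (simp add: field_simps)
  qed
  define E where "E h = Cblinfun (\<lambda>f. d f h)" for h
  have E: "cblinfun_apply (E h) f = d f h" for h f
  proof -
    have "bounded_clinear (\<lambda>f. d f h)"
      by (rule bounded_clinear_intro[where K = "norm h"])
        (simp_all only: d_add d_scale scaleC_complex_def d_le)
    then show ?thesis by (simp add: E_def Cblinfun_inverse)
  qed
  have "tau0_continuous (E h)" for h
  proof (rule tau0_continuous_limit)
    define X where "X n = real (Suc n) *\<^sub>R (evaluation (x + inverse (real (Suc n)) *\<^sub>R h) - evaluation x)" for n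
    show "tau0_continuous (X n)" for n
      unfolding X_def
      by (intro tau0_continuous_scaleR tau0_continuous_diff tau0_continuous_evaluation)
    have "\<forall>\<^sub>F n in sequentially. inverse (real (Suc n)) * norm h < r"
      using tendsto_mult_left_zero[OF LIMSEQ_inverse_real_of_nat, of "norm h"] r
      by (auto dest: order_tendstoD)
    then have "\<forall>\<^sub>F n in sequentially. norm (X n - E h) \<le> inverse (real (Suc n)) * (3 * (norm h)\<^sup>2 / r)"
    proof eventually_elim
      case (elim n)
      define t where "t = inverse (real (Suc n))"
      have t: "t > 0" "real (Suc n) * t = 1" "real (Suc n) > 0" by (simp_all add: t_def)
      have "norm (cblinfun_apply (X n - E h) f) \<le> t * (3 * (norm h)\<^sup>2 / r)" if f: "norm f \<le> 1" for f
      proof -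
        let ?e = "HL0_apply f (x + t *\<^sub>R h) - HL0_apply f x - d f (t *\<^sub>R h)"
        have "d f h = real (Suc n) *\<^sub>R d f (t *\<^sub>R h)"
          by (simp only: d_h(3) scaleR_scaleR t(2) scaleR_one)
        then have "cblinfun_apply (X n - E h) f = real (Suc n) *\<^sub>R ?e"
          unfolding X_def t_def[symmetric] minus_cblinfun.rep_eq scaleR_cblinfun.rep_eq E evaluation.rep_eq
          by (simp only: scaleR_diff_right)
        moreover have "cmod ?e \<le> 3 * (norm (t *\<^sub>R h))\<^sup>2 / r"
          using elim t(1) by (intro estimate[OF f]) (simp add: t_def)
        ultimately have "cmod (cblinfun_apply (X n - E h) f) \<le> real (Suc n) * (3 * (norm (t *\<^sub>R h))\<^sup>2 / r)"
          using t(3) by (simp only: norm_scaleR abs_of_pos mult_left_mono less_imp_le)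
        also have "\<dots> = (real (Suc n) * t) * (t * (3 * (norm h)\<^sup>2 / r))"
          by (simp add: power_mult_distrib power2_eq_square)
        finally show ?thesis by (simp only: t(2) mult_1)
      qed
      then show ?case unfolding t_def[symmetric] by (rule norm_functional_bound)
    qed
    then have "(\<lambda>n. X n - E h) \<longlonglongrightarrow> 0"
      by (rule Lim_null_comparison) (rule tendsto_mult_left_zero[OF LIMSEQ_inverse_real_of_nat])
    then show "X \<longlonglongrightarrow> E h" by (simp add: LIM_zero_iff)
  qed
  then have G: "G0_apply (G0_Abs (E h)) f = d f h" for h f
    by (simp add: G0_apply_def G0_Abs_inverse E)
  define D where "D h = G0_Abs (E h)" for h
  have D_clinear: "bounded_clinear D"
  proof (rule bounded_clinear_intro[where K = 1])
    show "D (h + k) = D h + D k" for h k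
      by (rule G0_eqI) (simp add: D_def G G0_apply_simps d_h)
    show "D (c *\<^sub>C h) = c *\<^sub>C D h" for c h
      by (rule G0_eqI) (simp add: D_def G G0_apply_simps d_h)
    show "norm (D h) \<le> 1 * norm h" for h
      by (rule norm_G0_bound) (simp add: D_def G d_le_1)
  qed
  have "norm (delta y - delta x - D (y - x)) \<le> 3 * (norm (y - x))\<^sup>2 / r" if "norm (y - x) < r" for y
  proof (rule norm_G0_bound)
    fix f :: "('x, complex) HL0" assume "norm f \<le> 1"
    from estimate[OF this that] show "cmod (G0_apply (delta y - delta x - D (y - x)) f) \<le> 3 * (norm (y - x))\<^sup>2 / r"
      by (simp add: G0_apply_simps G0_apply_delta D_def G)
  qed
  then have "norm (delta y - delta x - D (y - x)) \<le> e * norm (y - x)"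
    if "norm (y - x) < min r (e * r / 3)" for e y
  proof -
    have "norm (delta y - delta x - D (y - x)) \<le> (3 * norm (y - x) / r) * norm (y - x)"
      using \<open>\<And>y. norm (y - x) < r \<Longrightarrow> _\<close>[of y] that by (simp add: power2_eq_square)
    also have "\<dots> \<le> e * norm (y - x)"
      using that r by (intro mult_right_mono) (auto simp: field_simps)
    finally show ?thesis .
  qed
  moreover have "min r (e * r / 3) > 0" if "e > 0" for e using r that by simp
  ultimately have "(delta has_derivative D) (at x)"
    using D_clinear unfolding has_derivative_at_alt bounded_clinear_def by blast
  with D_clinear show ?thesis by blast
qed

section \<open>The evaluation map is an isometry\<close>

lift_definition HL0_postcomp :: "('y, 'w) cblinfun \<Rightarrow> ('x::cbanach, 'y::cbanach) HL0 \<Rightarrow> ('x, 'w::cbanach) HL0"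
  is "\<lambda>T f x. T (f x)"
proof -
  fix T :: "'y \<Rightarrow> 'w" and f :: "'x \<Rightarrow> 'y"
  assume T: "bounded_clinear T" and f: "f \<in> HL0_set"
  then have bl: "bounded_linear T" by (simp add: bounded_clinear_def)
  have "holomorphic_map_on (\<lambda>x. T (f x)) (ball 0 1)"
    unfolding holomorphic_map_on_def
  proof
    fix x :: 'x assume "x \<in> ball 0 1"
    then obtain D where "bounded_clinear D" "(f has_derivative D) (at x)"
      using f unfolding HL0_set_def holomorphic_map_on_def by blast
    then show "\<exists>D. bounded_clinear D \<and> ((\<lambda>x. T (f x)) has_derivative D) (at x)"
      using T bl by (intro exI[of _ "\<lambda>h. T (D h)"])
        (auto simp: bounded_clinear_def intro: bounded_linear_compose bounded_linear.has_derivative)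
  qed
  moreover have "(onorm T * Lip f)-lipschitz_on (ball 0 1) (\<lambda>x. T (f x))"
  proof (rule lipschitz_onI)
    fix x y :: 'x assume xy: "x \<in> ball 0 1" "y \<in> ball 0 1"
    have "norm (T (f x - f y)) \<le> onorm T * norm (f x - f y)" by (rule onorm[OF bl])
    also have "\<dots> \<le> onorm T * (Lip f * norm (x - y))"
      using lipschitz_onD[OF HL0_set_lipschitz[OF f] xy] onorm_pos_le[OF bl]
      by (intro mult_left_mono) (simp_all add: dist_norm)
    finally show "dist (T (f x)) (T (f y)) \<le> onorm T * Lip f * dist x y"
      by (simp add: dist_norm linear_diff bounded_linear.linear[OF bl] mult.assoc)
  qed (simp add: onorm_pos_le[OF bl] Lip_nonneg[OF f])
  ultimately show "(\<lambda>x. T (f x)) \<in> HL0_set"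
    using f linear_0[OF bounded_linear.linear[OF bl]] by (auto simp: HL0_set_def)
qed

lemma norm_HL0_postcomp: "norm (HL0_postcomp T f) \<le> norm T * norm f"
proof (rule HL0_norm_bound)
  fix x y :: 'a assume "x \<in> ball 0 1" "y \<in> ball 0 1"
  then have "norm T * norm (HL0_apply f x - HL0_apply f y) \<le> norm T * (norm f * norm (x - y))"
    by (intro mult_left_mono HL0_apply_norm_diff) auto
  then show "norm (HL0_apply (HL0_postcomp T f) x - HL0_apply (HL0_postcomp T f) y)
      \<le> norm T * norm f * norm (x - y)"
    using norm_cblinfun[of T "HL0_apply f x - HL0_apply f y"]
    by (simp add: HL0_postcomp.rep_eq cblinfun_apply_diff mult.assoc)
qed simp

lift_definition HL0_inclusion :: "('x::cbanach, 'x) HL0"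
  is "\<lambda>x. if x \<in> ball 0 1 then x else 0"
proof -
  let ?\<iota> = "\<lambda>x :: 'x. if x \<in> ball 0 1 then x else 0"
  have "(?\<iota> has_derivative (\<lambda>h. h)) (at x)" if "x \<in> ball 0 1" for x
    by (rule has_derivative_transform_within_open[OF has_derivative_ident open_ball that]) simp
  moreover have "bounded_clinear (\<lambda>h :: 'x. h)"
    by (simp add: bounded_clinear_def bounded_linear_ident)
  ultimately have "holomorphic_map_on ?\<iota> (ball 0 1)" unfolding holomorphic_map_on_def by blast
  moreover have "1-lipschitz_on (ball 0 1) ?\<iota>" by (rule lipschitz_onI) auto
  ultimately show "?\<iota> \<in> HL0_set" by (auto simp: HL0_set_def)
qed

lemma norm_HL0_inclusion: "norm (HL0_inclusion :: ('x::cbanach, 'x) HL0) \<le> 1"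
  by (rule HL0_norm_bound) (auto simp: HL0_inclusion.rep_eq)

text \<open>The upper bound is the Lipschitz condition. For the lower one, restrict a norming functional of
\<open>x - y\<close> to the ball: the restriction has Lipschitz constant at most \<open>1\<close> and separates the two
evaluations by \<open>norm (x - y)\<close>.\<close>

theorem delta_isometric:
  fixes x y :: "'x::cbanach"
  assumes x: "x \<in> ball 0 1" and y: "y \<in> ball 0 1"
  shows "norm (delta x - delta y) = norm (x - y)"
proof (rule antisym)
  show "norm (delta x - delta y) \<le> norm (x - y)"
  proof (rule norm_G0_bound)
    fix f :: "('x, complex) HL0" assume f: "norm f \<le> 1"
    have "norm (HL0_apply f x - HL0_apply f y) \<le> norm f * norm (x - y)"
      using x y by (rule HL0_apply_norm_diff)
    also have "\<dots> \<le> 1 * norm (x - y)" using f by (intro mult_right_mono) auto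
    finally show "cmod (G0_apply (delta x - delta y) f) \<le> norm (x - y)"
      by (simp add: G0_apply_simps G0_apply_delta)
  qed
  obtain F :: "('x, complex) cblinfun"
    where F: "norm F \<le> 1" "cblinfun_apply F (x - y) = of_real (norm (x - y))"
    by (rule exists_norming_functional)
  define f where "f = HL0_postcomp F HL0_inclusion"
  have "norm f \<le> 1"
  proof -
    have "norm f \<le> norm F * norm (HL0_inclusion :: ('x, 'x) HL0)"
      unfolding f_def by (rule norm_HL0_postcomp)
    also have "\<dots> \<le> 1 * 1" by (intro mult_mono F(1) norm_HL0_inclusion) auto
    finally show ?thesis by simp
  qed
  have "norm (x - y) = cmod (G0_apply (delta x - delta y) f)"
    using x y F(2) by (simp add: G0_apply_simps G0_apply_delta f_def HL0_postcomp.rep_eq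
        HL0_inclusion.rep_eq cblinfun_apply_diff[symmetric])
  also have "\<dots> \<le> norm (delta x - delta y) * norm f" by (rule norm_G0_apply)
  also have "\<dots> \<le> norm (delta x - delta y) * 1" using \<open>norm f \<le> 1\<close> by (intro mult_left_mono) auto
  finally show "norm (x - y) \<le> norm (delta x - delta y)" by simp
qed

lemma delta_outside: "x \<notin> ball 0 1 \<Longrightarrow> delta x = 0"
  by (rule G0_eqI) (simp add: G0_apply_delta G0_apply_simps HL0_apply_outside)

lemma delta_holomorphic: "holomorphic_map_on delta (ball 0 1)"
  unfolding holomorphic_map_on_def using delta_has_derivative by auto

lemma delta_lipschitz: "1-lipschitz_on (ball 0 1) delta"
  by (rule lipschitz_onI) (simp_all only: dist_norm delta_isometric mult_1 order_refl zero_le_one)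

lemma delta_in_HL0_set: "delta \<in> HL0_set"
proof -
  have "delta 0 = 0" by (rule G0_eqI) (simp add: G0_apply_delta G0_apply_simps)
  then show ?thesis
    using delta_holomorphic delta_lipschitz delta_outside unfolding HL0_set_def by blast
qed

lemma Lip_delta:
  assumes "\<exists>x :: 'x::cbanach. x \<noteq> 0"
  shows "Lip (delta :: 'x \<Rightarrow> 'x G0) = 1"
proof (rule antisym)
  show "Lip (delta :: 'x \<Rightarrow> 'x G0) \<le> 1" by (rule Lip_le[OF delta_lipschitz])
  obtain a :: 'x where a: "a \<noteq> 0" using assms by blast
  define x where "x = (1 / (2 * norm a)) *\<^sub>R a"
  have x: "norm x = 1 / 2" "x \<in> ball 0 1" using a by (simp_all add: x_def)
  have "norm (delta x - delta 0) \<le> Lip (delta :: 'x \<Rightarrow> 'x G0) * norm (x - 0)"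
    using lipschitz_onD[OF HL0_set_lipschitz[OF delta_in_HL0_set] x(2), of 0] by (simp add: dist_norm)
  then show "1 \<le> Lip (delta :: 'x \<Rightarrow> 'x G0)"
    using delta_isometric[OF x(2), of 0] x(1) by simp
qed

section \<open>Linearization of vector-valued maps\<close>

lemma bounded_linear_G0_apply: "bounded_linear (\<lambda>\<phi>. G0_apply \<phi> f)"
  by (rule bounded_linear_intro[where K = "norm f"])
    (simp_all only: scaleR_scaleC scaleC_complex_def G0_apply_simps norm_G0_apply)

text \<open>The set where two operators agree is a closed subspace, and the evaluations span a dense one.\<close>

lemma G0_operator_eqI:
  fixes S T :: "('x::cbanach G0, 'y::cbanach) cblinfun"
  assumes eq: "\<And>x. x \<in> ball 0 1 \<Longrightarrow> cblinfun_apply S (delta x) = cblinfun_apply T (delta x)"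
  shows "S = T"
proof (rule cblinfun_eqI)
  let ?E = "{\<phi>. cblinfun_apply (S - T) \<phi> = 0}"
  have "closed ?E"
    by (intro closed_Collect_eq continuous_on_const
        linear_continuous_on bounded_linear_cblinfun_apply)
  moreover have "cspan (delta ` ball 0 1) \<subseteq> ?E"
  proof (rule complex_vector.span_minimal)
    show "delta ` ball 0 1 \<subseteq> ?E" using eq by (auto simp: minus_cblinfun.rep_eq)
    show "complex_vector.subspace ?E"
      by (auto simp: complex_vector.subspace_def cblinfun_apply_add cblinfun_apply_scaleC scaleC_zero_right)
  qed
  ultimately have "closure (cspan (delta ` ball 0 1)) \<subseteq> ?E" by (rule closure_minimal[rotated])
  then show "cblinfun_apply S \<phi> = cblinfun_apply T \<phi>" for \<phi>
    by (auto simp: delta_span_dense minus_cblinfun.rep_eq)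
qed

text \<open>The value at \<open>\<phi>\<close> of the operator that linearizes \<open>f\<close> is determined by testing with functionals
\<open>F\<close>, since \<open>F\<close> composed with that operator linearizes \<open>F \<circ> f\<close>. Defining the value as a solution of
these equations avoids a separate proof that the formula on linear combinations of evaluations is
independent of the chosen combination.\<close>

definition represents :: "('x::cbanach, 'y::cbanach) HL0 \<Rightarrow> 'x G0 \<Rightarrow> 'y \<Rightarrow> bool" where
  "represents f \<phi> y \<longleftrightarrow> (\<forall>F. cblinfun_apply F y = G0_apply \<phi> (HL0_postcomp F f))"

lemma represents_delta: "represents f (delta x) (HL0_apply f x)"
  by (simp add: represents_def G0_apply_delta HL0_postcomp.rep_eq)

lemma represents_zero: "represents f 0 0"
  by (simp add: represents_def G0_apply_simps)

lemma represents_add: "represents f \<phi> y \<Longrightarrow> represents f \<psi> z \<Longrightarrow> represents f (\<phi> + \<psi>) (y + z)"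
  by (simp add: represents_def G0_apply_simps cblinfun_apply_add)

lemma represents_diff: "represents f \<phi> y \<Longrightarrow> represents f \<psi> z \<Longrightarrow> represents f (\<phi> - \<psi>) (y - z)"
  by (simp add: represents_def G0_apply_simps cblinfun_apply_diff)

lemma represents_scaleC: "represents f \<phi> y \<Longrightarrow> represents f (c *\<^sub>C \<phi>) (c *\<^sub>C y)"
  by (simp add: represents_def G0_apply_simps cblinfun_apply_scaleC scaleC_complex_def)

text \<open>Test with a norming functional of \<open>y\<close>. Applied to differences, this gives both uniqueness of \<open>y\<close>
and continuity of its dependence on \<open>\<phi>\<close>.\<close>

lemma represents_norm_le:
  assumes "represents f \<phi> y"
  shows "norm y \<le> norm f * norm \<phi>"
proof -
  obtain F :: "('b, complex) cblinfun" where F: "norm F \<le> 1" "cblinfun_apply F y = of_real (norm y)"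
    by (rule exists_norming_functional)
  have "norm y = cmod (G0_apply \<phi> (HL0_postcomp F f))"
    using assms F(2) by (metis represents_def norm_of_real abs_norm_cancel)
  also have "\<dots> \<le> norm \<phi> * norm (HL0_postcomp F f)" by (rule norm_G0_apply)
  also have "\<dots> \<le> norm \<phi> * (1 * norm f)"
    by (intro mult_left_mono order_trans[OF norm_HL0_postcomp] mult_right_mono F(1)) auto
  finally show ?thesis by (simp add: mult.commute)
qed

lemma represents_unique:
  assumes "represents f \<phi> y" "represents f \<phi> z"
  shows "y = z"
  using represents_norm_le[OF represents_diff[OF assms]] by simp

text \<open>The functionals with a representing vector contain the span of the evaluations, and they form a
closed set, because representing vectors of a Cauchy sequence are a Cauchy sequence.\<close>

lemma exists_represents:
  fixes f :: "('x::cbanach, 'y::cbanach) HL0"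
  shows "\<exists>y. represents f \<phi> y"
proof -
  have span: "\<exists>y. represents f \<psi> y" if "\<psi> \<in> cspan (delta ` ball 0 1)" for \<psi>
    using that
  proof (induction rule: complex_vector.span_induct_alt)
    case base
    show ?case using represents_zero by blast
  next
    case (step c e \<psi>)
    then obtain x y where "e = delta x" "represents f \<psi> y" by auto
    then show ?case using represents_add[OF represents_scaleC[OF represents_delta]] by blast
  qed
  obtain X where X: "\<And>n. X n \<in> cspan (delta ` ball 0 1)" "X \<longlonglongrightarrow> \<phi>"
    using closure_sequential[of \<phi> "cspan (delta ` ball 0 1)"] by (auto simp: delta_span_dense)
  obtain y where y: "\<And>n. represents f (X n) (y n)" using span[OF X(1)] by metis
  have "Cauchy y"
  proof (rule metric_CauchyI)
    fix e :: real assume e: "e > 0"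
    have pos: "norm f + 1 > 0" by (simp add: add_nonneg_pos)
    then have "e / (norm f + 1) > 0" using e by simp
    then obtain N where N: "\<And>m n. m \<ge> N \<Longrightarrow> n \<ge> N \<Longrightarrow> dist (X m) (X n) < e / (norm f + 1)"
      using metric_CauchyD[OF LIMSEQ_imp_Cauchy[OF X(2)]] by blast
    have "dist (y m) (y n) < e" if "m \<ge> N" "n \<ge> N" for m n
    proof -
      have "dist (y m) (y n) \<le> norm f * dist (X m) (X n)"
        using represents_norm_le[OF represents_diff[OF y y]] by (simp add: dist_norm)
      also have "\<dots> \<le> (norm f + 1) * dist (X m) (X n)" by (intro mult_right_mono) auto
      also have "\<dots> < e" using N[OF that] pos by (simp add: pos_less_divide_eq mult.commute)
      finally show ?thesis .
    qed
    then show "\<exists>N. \<forall>m\<ge>N. \<forall>n\<ge>N. dist (y m) (y n) < e" by blast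
  qed
  then obtain z where z: "y \<longlonglongrightarrow> z" using Cauchy_convergent convergent_def by blast
  have "represents f \<phi> z"
    unfolding represents_def
  proof
    fix F :: "('y, complex) cblinfun"
    have "(\<lambda>n. cblinfun_apply F (y n)) \<longlonglongrightarrow> cblinfun_apply F z"
      by (rule bounded_linear.tendsto[OF bounded_linear_cblinfun_apply z])
    moreover have "(\<lambda>n. cblinfun_apply F (y n)) \<longlonglongrightarrow> G0_apply \<phi> (HL0_postcomp F f)"
      using bounded_linear.tendsto[OF bounded_linear_G0_apply X(2)] y by (simp add: represents_def)
    ultimately show "cblinfun_apply F z = G0_apply \<phi> (HL0_postcomp F f)" by (rule LIMSEQ_unique)
  qed
  then show ?thesis by blast
qed

theorem exists_linearization:
  fixes f :: "('x::cbanach, 'y::cbanach) HL0"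
  obtains T where "linearizes delta f T" "norm T \<le> norm f"
proof -
  define t where "t \<phi> = (SOME y. represents f \<phi> y)" for \<phi>
  have t: "represents f \<phi> (t \<phi>)" for \<phi>
    unfolding t_def using exists_represents by (rule someI_ex)
  have "bounded_clinear t"
  proof (rule bounded_clinear_intro[where K = "norm f"])
    show "t (\<phi> + \<psi>) = t \<phi> + t \<psi>" for \<phi> \<psi> by (rule represents_unique[OF t represents_add[OF t t]])
    show "t (c *\<^sub>C \<phi>) = c *\<^sub>C t \<phi>" for c \<phi> by (rule represents_unique[OF t represents_scaleC[OF t]])
    show "norm (t \<phi>) \<le> norm f * norm \<phi>" for \<phi> by (rule represents_norm_le[OF t])
  qed
  then have T: "cblinfun_apply (Cblinfun t) = t" by (simp add: Cblinfun_inverse)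
  show thesis
  proof (rule that)
    show "linearizes delta f (Cblinfun t)"
      unfolding linearizes_def T by (blast intro: represents_unique t represents_delta)
    show "norm (Cblinfun t) \<le> norm f"
      by (rule norm_cblinfun_bound) (simp_all add: T represents_norm_le[OF t])
  qed
qed

text \<open>The two norms agree since the linearization has norm at most that of \<open>f\<close>, while \<open>f\<close> is the
linearization composed with an isometric embedding of the ball.\<close>

theorem universal_delta: "universal_for TYPE('y::cbanach) (delta :: 'x::cbanach \<Rightarrow> 'x G0)"
proof -
  have unique: "S = T" if "linearizes delta f S" "linearizes delta f T"
    for f :: "('x, 'y) HL0" and S T
    using that by (intro G0_operator_eqI) (simp add: linearizes_def)
  have ex1: "\<exists>!T. linearizes delta f T" for f :: "('x, 'y) HL0"
    using exists_linearization[of f] unique by metis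
  define L where "L f = (THE T. linearizes delta f T)" for f :: "('x, 'y) HL0"
  have L: "linearizes delta f (L f)" for f unfolding L_def by (rule theI'[OF ex1])
  have L_eq: "L f = T" if "linearizes delta f T" for f T using unique[OF L that] .
  have norm_L: "norm (L f) = norm f" for f
  proof (rule antisym)
    show "norm (L f) \<le> norm f" using exists_linearization[of f] L_eq by metis
    show "norm f \<le> norm (L f)"
    proof (rule HL0_norm_bound)
      fix x y :: 'x assume xy: "x \<in> ball 0 1" "y \<in> ball 0 1"
      then have "HL0_apply f x - HL0_apply f y = cblinfun_apply (L f) (delta x - delta y)"
        using L[of f] by (simp add: linearizes_def cblinfun_apply_diff)
      then show "norm (HL0_apply f x - HL0_apply f y) \<le> norm (L f) * norm (x - y)"
        using norm_cblinfun[of "L f" "delta x - delta y"] delta_isometric[OF xy] by simp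
    qed simp
  qed
  have "bounded_clinear L"
  proof (rule bounded_clinear_intro[where K = 1])
    show "L (f + g) = L f + L g" for f g
      using L[of f] L[of g] by (intro L_eq) (simp add: linearizes_def plus_cblinfun.rep_eq plus_HL0.rep_eq)
    show "L (c *\<^sub>C f) = c *\<^sub>C L f" for c f
      using L[of f] by (intro L_eq) (simp add: linearizes_def scaleC_cblinfun.rep_eq scaleC_HL0.rep_eq)
  qed (simp add: norm_L)
  moreover have "surj L"
  proof (rule surjI)
    fix T :: "('x G0, 'y) cblinfun"
    show "L (HL0_postcomp T (HL0_Abs delta)) = T"
      by (intro L_eq) (simp add: linearizes_def HL0_postcomp.rep_eq HL0_Abs_inverse delta_in_HL0_set)
  qed
  ultimately have "isometric_isomorphism L" by (simp add: isometric_isomorphism_def norm_L)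
  then show ?thesis unfolding universal_for_def L_def using ex1 by blast
qed

section \<open>Uniqueness of the predual\<close>

lift_definition cblinfun_id :: "('a::complex_normed_vector, 'a) cblinfun" is "\<lambda>x. x"
  by (simp add: bounded_clinear_def bounded_linear_ident)

lift_definition cblinfun_compose ::
  "('b::complex_normed_vector, 'c::complex_normed_vector) cblinfun \<Rightarrow>
   ('a::complex_normed_vector, 'b) cblinfun \<Rightarrow> ('a, 'c) cblinfun" is "\<lambda>S T x. S (T x)"
  by (simp add: bounded_clinear_def bounded_linear_compose)

lemma universal_norm_eq:
  fixes d :: "'x::cbanach \<Rightarrow> 'z::cbanach" and f :: "('x, 'y::cbanach) HL0"
  assumes "universal_for TYPE('y) d" "linearizes d f T"
  shows "norm T = norm f"
  using assms unfolding universal_for_def isometric_isomorphism_def by (metis the1_equality)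

lemma universal_operator_eqI:
  fixes d :: "'x::cbanach \<Rightarrow> 'z::cbanach" and S T :: "('z, 'y::cbanach) cblinfun"
  assumes "universal_for TYPE('y) d" "linearizes d f S" "linearizes d f T"
  shows "S = T"
  using assms unfolding universal_for_def by blast

text \<open>Linearize each of \<open>d\<close> and \<open>d'\<close> over the other. Both composites linearize what the identity
linearizes, so the two operators are mutually inverse. Each has norm at most \<open>1\<close>, since the
Lipschitz constant of \<open>d\<close> is the norm of the identity, its linearization over itself, and likewise
for \<open>d'\<close>; contractions that are mutually inverse are isometries.\<close>

theorem universal_objects_isometric:
  fixes d :: "'x::cbanach \<Rightarrow> 'z::cbanach" and d' :: "'x \<Rightarrow> 'w::cbanach"
  assumes d: "d \<in> HL0_set" and d': "d' \<in> HL0_set"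
    and zz: "universal_for TYPE('z) d" and zw: "universal_for TYPE('w) d"
    and wz: "universal_for TYPE('z) d'" and ww: "universal_for TYPE('w) d'"
  shows "\<exists>J :: 'z \<Rightarrow> 'w. isometric_isomorphism J"
proof -
  have fd: "HL0_apply (HL0_Abs d) = d" and fd': "HL0_apply (HL0_Abs d') = d'"
    by (simp_all add: HL0_Abs_inverse d d')
  obtain T :: "('z, 'w) cblinfun" where T: "linearizes d (HL0_Abs d') T"
    using zw unfolding universal_for_def by blast
  obtain S :: "('w, 'z) cblinfun" where S: "linearizes d' (HL0_Abs d) S"
    using wz unfolding universal_for_def by blast
  have id_d: "linearizes d (HL0_Abs d) cblinfun_id" and id_d': "linearizes d' (HL0_Abs d') cblinfun_id"
    by (simp_all add: linearizes_def cblinfun_id.rep_eq fd fd')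
  have id_le: "norm (cblinfun_id :: ('a::complex_normed_vector, 'a) cblinfun) \<le> 1"
    by (rule norm_cblinfun_bound) (simp_all add: cblinfun_id.rep_eq)
  have "norm T \<le> 1" "norm S \<le> 1"
    using universal_norm_eq[OF zw T] universal_norm_eq[OF ww id_d']
      universal_norm_eq[OF wz S] universal_norm_eq[OF zz id_d] id_le by metis+
  have "cblinfun_compose S T = cblinfun_id" "cblinfun_compose T S = cblinfun_id"
    using T S by (auto intro!: universal_operator_eqI[OF zz _ id_d] universal_operator_eqI[OF ww _ id_d']
        simp: linearizes_def cblinfun_compose.rep_eq fd fd')
  then have ST: "cblinfun_apply S (cblinfun_apply T z) = z"
    and TS: "cblinfun_apply T (cblinfun_apply S w) = w" for z w
    by (metis cblinfun_compose.rep_eq cblinfun_id.rep_eq)+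
  have "norm (cblinfun_apply T z) = norm z" for z
  proof (rule antisym)
    show "norm (cblinfun_apply T z) \<le> norm z"
      using norm_cblinfun[of T z] mult_right_mono[OF \<open>norm T \<le> 1\<close>, of "norm z"] by simp
    show "norm z \<le> norm (cblinfun_apply T z)"
      using norm_cblinfun[of S "cblinfun_apply T z"]
        mult_right_mono[OF \<open>norm S \<le> 1\<close>, of "norm (cblinfun_apply T z)"] by (simp add: ST)
  qed
  moreover have "surj (cblinfun_apply T)" by (rule surjI) (rule TS)
  ultimately show ?thesis
    unfolding isometric_isomorphism_def using bounded_clinear_cblinfun_apply by blast
qed

section \<open>Bounded weak-star convergence\<close>

text \<open>Convergence for a topology generated by preimages is only to be checked on the generators, because
eventual membership passes to finite intersections and to larger sets.\<close>

lemma limitin_weak_star_iff: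
  "limitin weak_star F f N \<longleftrightarrow> (\<forall>\<phi>. ((\<lambda>a. G0_apply \<phi> (F a)) \<longlongrightarrow> G0_apply \<phi> f) N)"
proof (intro iffI allI)
  fix \<phi> assume L: "limitin weak_star F f N"
  show "((\<lambda>a. G0_apply \<phi> (F a)) \<longlongrightarrow> G0_apply \<phi> f) N"
  proof (rule topological_tendstoI)
    fix U assume U: "open U" "G0_apply \<phi> f \<in> U"
    have "openin weak_star ((\<lambda>f. G0_apply \<phi> f) -` U)"
      unfolding weak_star_def using U(1) by (intro topology_generated_by_Basis) blast
    then show "\<forall>\<^sub>F a in N. G0_apply \<phi> (F a) \<in> U"
      using L U(2) unfolding limitin_def by fastforce
  qed
next
  assume R: "\<forall>\<phi>. ((\<lambda>a. G0_apply \<phi> (F a)) \<longlongrightarrow> G0_apply \<phi> f) N"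
  have "\<forall>\<^sub>F a in N. F a \<in> V" if "openin weak_star V" "f \<in> V" for V
    using openin_topology_generated_by[OF that(1)[unfolded weak_star_def]] that(2)
  proof (induction rule: generate_topology_on.induct)
    case (Int A B)
    then show ?case by (simp add: eventually_conj_iff)
  next
    case (UN \<A>)
    then obtain A where "A \<in> \<A>" "\<forall>\<^sub>F a in N. F a \<in> A" by blast
    then show ?case by (auto elim: eventually_mono)
  next
    case (Basis A)
    then obtain \<phi> U where "A = (\<lambda>f. G0_apply \<phi> f) -` U" "open U" by blast
    then show ?case using R Basis.prems topological_tendstoD by fastforce
  qed simp
  moreover have "f \<in> topspace weak_star"
    unfolding weak_star_def topology_generated_by_topspace by (auto intro!: exI[of _ UNIV])
  ultimately show "limitin weak_star F f N" unfolding limitin_def by blast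
qed

text \<open>Pointwise convergence is convergence against the evaluations, hence against their span. For bounded
families, approximation in the norm of the predual is uniform, so convergence extends to the
closure of the span.\<close>

theorem bounded_weak_star_limit_iff_pointwise:
  fixes F :: "'i \<Rightarrow> ('x::cbanach, complex) HL0"
  assumes bounded: "\<forall>\<^sub>F a in N. norm (F a) \<le> C"
  shows "limitin weak_star F f N \<longleftrightarrow>
    (\<forall>x\<in>ball 0 1. ((\<lambda>a. HL0_apply (F a) x) \<longlongrightarrow> HL0_apply f x) N)"
proof
  assume "limitin weak_star F f N"
  then show "\<forall>x\<in>ball 0 1. ((\<lambda>a. HL0_apply (F a) x) \<longlongrightarrow> HL0_apply f x) N"
    unfolding limitin_weak_star_iff G0_apply_delta[symmetric] by blast
next
  assume pointwise: "\<forall>x\<in>ball 0 1. ((\<lambda>a. HL0_apply (F a) x) \<longlongrightarrow> HL0_apply f x) N"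
  have span: "((\<lambda>a. G0_apply \<psi> (F a)) \<longlongrightarrow> G0_apply \<psi> f) N" if "\<psi> \<in> cspan (delta ` ball 0 1)" for \<psi>
    using that
  proof (induction rule: complex_vector.span_induct_alt)
    case base
    show ?case by (simp add: G0_apply_simps)
  next
    case (step c e \<psi>)
    then show ?case using pointwise
      by (auto simp: G0_apply_simps G0_apply_delta intro!: tendsto_intros)
  qed
  have "((\<lambda>a. G0_apply \<phi> (F a)) \<longlongrightarrow> G0_apply \<phi> f) N" for \<phi>
  proof (rule tendstoI)
    fix e :: real assume e: "e > 0"
    define B where "B = \<bar>C\<bar> + norm f + 1"
    have B: "B > 0" "norm f \<le> B" "C \<le> B" 
      unfolding B_def using norm_ge_zero[of f] abs_ge_self[of C] by linarith+
    have "e / (3 * B) > 0" using e B(1) by simp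
    then obtain \<psi> where \<psi>: "\<psi> \<in> cspan (delta ` ball 0 1)" "dist \<psi> \<phi> < e / (3 * B)"
      using delta_span_dense[where 'x = 'x] by (metis UNIV_I closure_approachable)
    have close: "dist (G0_apply \<phi> g) (G0_apply \<psi> g) < e / 3" if "norm g \<le> B" for g
    proof -
      have "dist (G0_apply \<phi> g) (G0_apply \<psi> g) \<le> dist \<phi> \<psi> * norm g"
        using norm_G0_apply[of "\<phi> - \<psi>" g] by (simp add: dist_norm G0_apply_simps)
      also have "\<dots> \<le> dist \<phi> \<psi> * B" using that by (intro mult_left_mono) auto
      also have "\<dots> < e / 3" using \<psi>(2) B(1) by (simp add: dist_commute field_simps)
      finally show ?thesis .
    qed
    from tendstoD[OF span[OF \<psi>(1)], of "e / 3"] e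
    have "\<forall>\<^sub>F a in N. dist (G0_apply \<psi> (F a)) (G0_apply \<psi> f) < e / 3" by simp
    with bounded show "\<forall>\<^sub>F a in N. dist (G0_apply \<phi> (F a)) (G0_apply \<phi> f) < e"
    proof eventually_elim
      case (elim a)
      show ?case
      proof (rule dist_triangle_third)
        show "dist (G0_apply \<phi> (F a)) (G0_apply \<psi> (F a)) < e / 3" using elim(1) B(3) by (intro close) simp
        show "dist (G0_apply \<psi> (F a)) (G0_apply \<psi> f) < e / 3" by (rule elim(2))
        show "dist (G0_apply \<psi> f) (G0_apply \<phi> f) < e / 3" using close[OF B(2)] by (simp add: dist_commute)
      qed
    qed
  qed
  then show "limitin weak_star F f N" by (simp add: limitin_weak_star_iff)
qed

section \<open>The properties of the predual\<close>

theorem proposition2p5: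
  assumes "\<exists>x :: 'x::cbanach. x \<noteq> 0"
  shows
    \<comment> \<open>(a)\<close>
    "holomorphic_map_on (delta :: 'x \<Rightarrow> 'x G0) (ball 0 1) \<and>
     (\<forall>x\<in>ball 0 1. \<forall>y\<in>ball 0 1. norm (delta x - delta y) = norm (x - y :: 'x)) \<and>
     (delta :: 'x \<Rightarrow> 'x G0) \<in> HL0_set \<and> Lip (delta :: 'x \<Rightarrow> 'x G0) = 1 \<and>
     \<comment> \<open>(b)\<close>
     (UNIV :: 'x G0 set) = closure (cspan (delta ` ball 0 1)) \<and>
     \<comment> \<open>(c)\<close>
     universal_for TYPE('y::cbanach) (delta :: 'x \<Rightarrow> 'x G0) \<and>
     (\<forall>dZ :: 'x \<Rightarrow> 'z::cbanach. dZ \<in> HL0_set \<longrightarrow>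
        universal_for TYPE('z) dZ \<longrightarrow> universal_for TYPE('x G0) dZ \<longrightarrow>
        (\<exists>J :: 'z \<Rightarrow> 'x G0. isometric_isomorphism J)) \<and>
     \<comment> \<open>(d)\<close>
     (\<forall>(I :: 'i set) le (F :: 'i \<Rightarrow> ('x, complex) HL0) f.
        directed I le \<longrightarrow> (\<exists>C. \<forall>a\<in>I. norm (F a) \<le> C) \<longrightarrow>
        (limitin weak_star F f (tail_filter I le) \<longleftrightarrow>
         (\<forall>x\<in>ball 0 1. ((\<lambda>a. HL0_apply (F a) x) \<longlongrightarrow> HL0_apply f x) (tail_filter I le))))"
proof (intro conjI)
  show "holomorphic_map_on (delta :: 'x \<Rightarrow> 'x G0) (ball 0 1)" by (rule delta_holomorphic)
  show "\<forall>x\<in>ball 0 1. \<forall>y\<in>ball 0 1. norm (delta x - delta y) = norm (x - y :: 'x)"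
    using delta_isometric by blast
  show "(delta :: 'x \<Rightarrow> 'x G0) \<in> HL0_set" by (rule delta_in_HL0_set)
  show "Lip (delta :: 'x \<Rightarrow> 'x G0) = 1" using assms by (rule Lip_delta)
  show "(UNIV :: 'x G0 set) = closure (cspan (delta ` ball 0 1))" by (rule delta_span_dense[symmetric])
  show "universal_for TYPE('y) (delta :: 'x \<Rightarrow> 'x G0)" by (rule universal_delta)
  show "\<forall>dZ :: 'x \<Rightarrow> 'z. dZ \<in> HL0_set \<longrightarrow>
      universal_for TYPE('z) dZ \<longrightarrow> universal_for TYPE('x G0) dZ \<longrightarrow>
      (\<exists>J :: 'z \<Rightarrow> 'x G0. isometric_isomorphism J)"
    by (intro allI impI universal_objects_isometric[OF _ delta_in_HL0_set _ _ universal_delta universal_delta])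
  show "\<forall>(I :: 'i set) le (F :: 'i \<Rightarrow> ('x, complex) HL0) f.
      directed I le \<longrightarrow> (\<exists>C. \<forall>a\<in>I. norm (F a) \<le> C) \<longrightarrow>
      (limitin weak_star F f (tail_filter I le) \<longleftrightarrow>
       (\<forall>x\<in>ball 0 1. ((\<lambda>a. HL0_apply (F a) x) \<longlongrightarrow> HL0_apply f x) (tail_filter I le)))"
  proof (intro allI impI)
    fix I :: "'i set" and le and F :: "'i \<Rightarrow> ('x, complex) HL0" and f
    assume I: "directed I le" and "\<exists>C. \<forall>a\<in>I. norm (F a) \<le> C"
    then obtain C where C: "\<And>a. a \<in> I \<Longrightarrow> norm (F a) \<le> C" by blast
    have "tail_filter I le \<le> principal I"
      using I unfolding tail_filter_def directed_def by (auto intro: INF_lower2)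
    then have "\<forall>\<^sub>F a in tail_filter I le. norm (F a) \<le> C"
      using C by (auto simp: le_principal elim: eventually_mono)
    then show "limitin weak_star F f (tail_filter I le) \<longleftrightarrow>
        (\<forall>x\<in>ball 0 1. ((\<lambda>a. HL0_apply (F a) x) \<longlongrightarrow> HL0_apply f x) (tail_filter I le))"
      by (rule bounded_weak_star_limit_iff_pointwise)
  qed
qed

end
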